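(* Let $A=\mathbb{R}[X_1,\ldots,X_n]=\bigoplus_{\gamma\in\Gamma}A_\gamma$ be a grading and let $M$ be a finitely generated quadratic module in $A$. (1) If for some finite set of (non-zero) generators $f_1,\ldots,f_s$ of $M$ the set $\mathcal{S}(f_1^{\max},\ldots,f_s^{\max})\subseteq\mathbb{R}^n$ is Zariski dense in $\mathbb{R}^n$, then $M$ is totally stable with respect to the grading. (2) If $M$ is closed under multiplication and $M$ is totally stable with respect to the grading, then $\mathcal{S}(f_1^{\max},\ldots,f_s^{\max})$ is Zariski dense in $\mathbb{R}^n$ for every finite set of (non-zero) generators $f_1,\ldots,f_s$ of $M$ (as a quadratic module).
   Context: Let $A=\mathbb{R}[X_1,\ldots,X_n]$. A quadratic module in $A$ is a subset $M\subseteq A$ with $1\in M$, $M+M\subseteq M$ and $a^2M\subseteq M$ for all $a\in A$. For $f_1,\ldots,f_s\in A$, $\mathrm{QM}(f_1,\ldots,f_s)=\{\sigma_0+\sigma_1f_1+\cdots+\sigma_sf_s\mid\sigma_i\in\sum A^2\}$ is the quadratic module generated by $f_1,\ldots,f_s$ ($\sum A^2$ is the set of sums of squares). Generators of a quadratic module are always assumed to be non-zero. $\mathcal{S}(f_1,\ldots,f_s)=\{x\in\mathbb{R}^n\mid f_1(x)\ge0,\ldots,f_s(x)\ge0\}$. $(\Gamma,\le)$ is an ordered Abelian group (an Abelian group with a linear ordering such that $\alpha\le\beta$ implies $\alpha+\gamma\le\beta+\gamma$). A grading of $A$ is a decomposition $A=\bigoplus_{\gamma\in\Gamma}A_\gamma$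 into linear subspaces with $A_\gamma A_{\gamma'}\subseteq A_{\gamma+\gamma'}$. A non-zero $f\in A$ is uniquely $f=f_{\gamma_1}+\cdots+f_{\gamma_d}$ with $0\ne f_{\gamma_i}\in A_{\gamma_i}$, $\gamma_1<\cdots<\gamma_d$; put $\deg(f)=\gamma_d$ and $f^{\max}=f_{\gamma_d}$; $\deg(0)=-\infty$. A finitely generated quadratic module $M$ is totally stable with respect to the grading if $\deg(f)\le\deg(f+g)$ for all $f,g\in M$. *)

theory Defs
  imports
    "HOL-Analysis.Analysis"
    "HOL-Library.Poly_Mapping"
    "HOL-Library.Extended"
begin

text \<open>The ring of real polynomials in the variables indexed by the finite type \<open>'n\<close>, as the
  monoid algebra of exponent vectors.\<close>

type_synonym 'n mpoly = "('n \<Rightarrow>\<^sub>0 nat) \<Rightarrow>\<^sub>0 real"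

definition eval_mpoly :: "'n::finite mpoly \<Rightarrow> real ^ 'n \<Rightarrow> real" where
  "eval_mpoly p x =
     (\<Sum>m\<in>Poly_Mapping.keys p. Poly_Mapping.lookup p m * (\<Prod>i\<in>UNIV. (x $ i) ^ Poly_Mapping.lookup m i))"

text \<open>Scalar multiplication on coefficients, so that the library constant \<open>subspace\<close> applies to
  sets of polynomials.\<close>

instantiation poly_mapping :: (type, real_vector) real_vector
begin

lift_definition scaleR_poly_mapping :: "real \<Rightarrow> ('a \<Rightarrow>\<^sub>0 'b) \<Rightarrow> ('a \<Rightarrow>\<^sub>0 'b)"
  is "\<lambda>r f x. r *\<^sub>R f x"
  by (erule rev_finite_subset) auto

instance
  by standard (transfer, simp add: fun_eq_iff scaleR_add_right scaleR_add_left)+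

end

subsection \<open>Gradings\<close>

text \<open>A finitely supported function \<open>c :: 'g \<Rightarrow>\<^sub>0 'n mpoly\<close> lists the homogeneous components of a
  polynomial; unique existence of such a \<open>c\<close> is the direct sum condition.\<close>

definition decomposes :: "('g \<Rightarrow> 'n mpoly set) \<Rightarrow> 'n mpoly \<Rightarrow> ('g \<Rightarrow>\<^sub>0 'n mpoly) \<Rightarrow> bool" where
  "decomposes A f c \<longleftrightarrow>
     (\<forall>\<gamma>. Poly_Mapping.lookup c \<gamma> \<in> A \<gamma>) \<and> f = (\<Sum>\<gamma>\<in>Poly_Mapping.keys c. Poly_Mapping.lookup c \<gamma>)"

definition grading :: "('g::linordered_ab_group_add \<Rightarrow> 'n mpoly set) \<Rightarrow> bool" where
  "grading A \<longleftrightarrow>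
     (\<forall>\<gamma>. subspace (A \<gamma>)) \<and>
     (\<forall>f. \<exists>!c. decomposes A f c) \<and>
     (\<forall>\<gamma> \<delta>. \<forall>p\<in>A \<gamma>. \<forall>q\<in>A \<delta>. p * q \<in> A (\<gamma> + \<delta>))"

definition components :: "('g \<Rightarrow> 'n mpoly set) \<Rightarrow> 'n mpoly \<Rightarrow> ('g \<Rightarrow>\<^sub>0 'n mpoly)" where
  "components A f = (THE c. decomposes A f c)"

definition gdeg :: "('g::linordered_ab_group_add \<Rightarrow> 'n mpoly set) \<Rightarrow> 'n mpoly \<Rightarrow> 'g extended" where
  "gdeg A f = (if f = 0 then Minf else Fin (Max (Poly_Mapping.keys (components A f))))"

text \<open>Only meaningful for non-zero \<open>f\<close>.\<close>

definition gmax :: "('g::linordered_ab_group_add \<Rightarrow> 'n mpoly set) \<Rightarrow> 'n mpoly \<Rightarrow> 'n mpoly" where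
  "gmax A f = Poly_Mapping.lookup (components A f) (Max (Poly_Mapping.keys (components A f)))"

subsection \<open>Quadratic modules\<close>

definition quadratic_module :: "'n mpoly set \<Rightarrow> bool" where
  "quadratic_module M \<longleftrightarrow>
     1 \<in> M \<and> (\<forall>f\<in>M. \<forall>g\<in>M. f + g \<in> M) \<and> (\<forall>a. \<forall>f\<in>M. a\<^sup>2 * f \<in> M)"

definition sums_of_squares :: "'n mpoly set" where
  "sums_of_squares = {\<Sum>i<k. (a i)\<^sup>2 | (k::nat) (a :: nat \<Rightarrow> 'n mpoly). True}"

definition QM :: "'n mpoly set \<Rightarrow> 'n mpoly set" where
  "QM F = {\<sigma>\<^sub>0 + (\<Sum>f\<in>F. \<sigma> f * f) | \<sigma>\<^sub>0 \<sigma>. \<sigma>\<^sub>0 \<in> sums_of_squares \<and> (\<forall>f\<in>F. \<sigma> f \<in> sums_of_squares)}"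

text \<open>Generators are non-zero by convention.\<close>

definition generators :: "'n mpoly set \<Rightarrow> 'n mpoly set \<Rightarrow> bool" where
  "generators F M \<longleftrightarrow> finite F \<and> 0 \<notin> F \<and> M = QM F"

definition fin_gen :: "'n mpoly set \<Rightarrow> bool" where
  "fin_gen M \<longleftrightarrow> (\<exists>F. generators F M)"

definition totally_stable :: "('g::linordered_ab_group_add \<Rightarrow> 'n mpoly set) \<Rightarrow> 'n mpoly set \<Rightarrow> bool" where
  "totally_stable A M \<longleftrightarrow> (\<forall>f\<in>M. \<forall>g\<in>M. gdeg A f \<le> gdeg A (f + g))"

definition nonneg_set :: "'n::finite mpoly set \<Rightarrow> (real ^ 'n) set" where
  "nonneg_set F = {x. \<forall>f\<in>F. eval_mpoly f x \<ge> 0}"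

subsection \<open>The Zariski topology\<close>

definition zariski_closed :: "(real ^ 'n::finite) set \<Rightarrow> bool" where
  "zariski_closed Z \<longleftrightarrow> (\<exists>P. Z = {x. \<forall>p\<in>P. eval_mpoly p x = 0})"

definition zariski :: "(real ^ 'n::finite) topology" where
  "zariski = topology (\<lambda>U. zariski_closed (- U))"

lemma eval_mpoly_superset:
  assumes "finite S" "Poly_Mapping.keys p \<subseteq> S"
  shows "eval_mpoly p x =
    (\<Sum>m\<in>S. Poly_Mapping.lookup p m * (\<Prod>i\<in>UNIV. (x $ i) ^ Poly_Mapping.lookup m i))"
  unfolding eval_mpoly_def
  by (rule sum.mono_neutral_left) (use assms in \<open>auto simp: in_keys_iff\<close>)

lemma eval_mpoly_zero [simp]: "eval_mpoly 0 x = 0"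
  by (simp add: eval_mpoly_def)

lemma eval_mpoly_single [simp]:
  "eval_mpoly (Poly_Mapping.single m c) x = c * (\<Prod>i\<in>UNIV. (x $ i) ^ Poly_Mapping.lookup m i)"
  by (subst eval_mpoly_superset[where S = "{m}"]) auto

lemma eval_mpoly_one [simp]: "eval_mpoly 1 x = 1"
  by (simp flip: single_one)

lemma eval_mpoly_add [simp]: "eval_mpoly (p + q) x = eval_mpoly p x + eval_mpoly q x"
proof -
  let ?S = "Poly_Mapping.keys p \<union> Poly_Mapping.keys q"
  have "Poly_Mapping.keys (p + q) \<subseteq> ?S" by (rule Poly_Mapping.keys_add)
  then show ?thesis
    by (simp add: eval_mpoly_superset[where S = ?S] lookup_add sum.distrib algebra_simps)
qed

lemma mpoly_induct [case_names single add]: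
  fixes p :: "'n mpoly"
  assumes "\<And>m c. P (Poly_Mapping.single m c)" and "\<And>p q. P p \<Longrightarrow> P q \<Longrightarrow> P (p + q)"
  shows "P p"
proof (induction p rule: update_induct)
  case const
  show ?case using assms(1)[of _ 0] by simp
next
  case (update p m c)
  have "Poly_Mapping.update m c p = p + Poly_Mapping.single m c"
    by (rule poly_mapping_eqI)
      (use update.hyps in \<open>auto simp: lookup_update lookup_add lookup_single in_keys_iff when_def\<close>)
  then show ?case using assms(2)[OF update.IH assms(1)] by simp
qed

lemma eval_mpoly_mult [simp]: "eval_mpoly (p * q) x = eval_mpoly p x * eval_mpoly q x"
proof (induction p rule: mpoly_induct)
  case (single m c)
  show ?case
    by (induction q rule: mpoly_induct)
      (auto simp: mult_single lookup_add power_add prod.distrib algebra_simps)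
next
  case (add p1 p2)
  then show ?case by (simp add: algebra_simps)
qed

lemma zariski_closed_Un:
  assumes "zariski_closed Y" "zariski_closed Z"
  shows "zariski_closed (Y \<union> Z)"
proof -
  obtain P Q where P: "Y = {x. \<forall>p\<in>P. eval_mpoly p x = 0}" and Q: "Z = {x. \<forall>q\<in>Q. eval_mpoly q x = 0}"
    using assms by (auto simp: zariski_closed_def)
  have "Y \<union> Z = {x. \<forall>r\<in>{p * q | p q. p \<in> P \<and> q \<in> Q}. eval_mpoly r x = 0}"
    unfolding P Q by fastforce
  then show ?thesis unfolding zariski_closed_def by blast
qed

lemma zariski_closed_Inter:
  assumes "\<And>Z. Z \<in> \<Z> \<Longrightarrow> zariski_closed Z"
  shows "zariski_closed (\<Inter>\<Z>)"
proof -
  have "\<forall>Z\<in>\<Z>. \<exists>P. \<forall>x. x \<in> Z \<longleftrightarrow> (\<forall>p\<in>P. eval_mpoly p x = 0)"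
    using assms unfolding zariski_closed_def by fastforce
  from bchoice[OF this] obtain P
    where mem: "\<And>Z x. Z \<in> \<Z> \<Longrightarrow> x \<in> Z \<longleftrightarrow> (\<forall>p\<in>P Z. eval_mpoly p x = 0)"
    by blast
  have "\<Inter>\<Z> = {x. \<forall>p\<in>(\<Union>Z\<in>\<Z>. P Z). eval_mpoly p x = 0}"
  proof (rule set_eqI)
    fix x
    show "x \<in> \<Inter>\<Z> \<longleftrightarrow> x \<in> {x. \<forall>p\<in>(\<Union>Z\<in>\<Z>. P Z). eval_mpoly p x = 0}"
      by (simp add: mem)
  qed
  then show ?thesis unfolding zariski_closed_def by blast
qed

lemma istopology_zariski: "istopology (\<lambda>U :: (real ^ 'n::finite) set. zariski_closed (- U))"
  unfolding istopology_def
proof (intro conjI allI impI)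
  fix U V :: "(real ^ 'n) set"
  assume "zariski_closed (- U)" "zariski_closed (- V)"
  then show "zariski_closed (- (U \<inter> V))"
    using zariski_closed_Un by (simp add: Compl_Int)
next
  fix \<U> :: "(real ^ 'n) set set"
  assume "\<forall>U\<in>\<U>. zariski_closed (- U)"
  then have "zariski_closed (\<Inter>(uminus ` \<U>))"
    by (intro zariski_closed_Inter) auto
  then show "zariski_closed (- \<Union>\<U>)"
    by (simp add: uminus_Sup)
qed

lemma openin_zariski: "openin zariski U \<longleftrightarrow> zariski_closed (- U)"
  by (simp add: zariski_def topology_inverse'[OF istopology_zariski])

lemma topspace_zariski [simp]: "topspace zariski = UNIV"
proof -
  have "zariski_closed (- UNIV :: (real ^ 'n::finite) set)"
    unfolding zariski_closed_def by (rule exI[of _ "{1}"]) auto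
  then show ?thesis by (metis openin_zariski openin_subset top.extremum_uniqueI)
qed

lemma closedin_zariski: "closedin zariski Z \<longleftrightarrow> zariski_closed Z"
  by (simp add: closedin_def openin_zariski flip: Compl_eq_Diff_UNIV)

definition zariski_dense :: "(real ^ 'n::finite) set \<Rightarrow> bool" where
  "zariski_dense S \<longleftrightarrow> zariski closure_of S = UNIV"

end

theory Submission
  imports "HOL-Algebra.Algebraic_Closure_Type" Defs
begin

text \<open>Both directions rest on one observation: the degree of \<open>f + g\<close> drops below the degree of a summand
exactly when the leading components of \<open>f\<close> and \<open>g\<close> lie in the same degree and cancel.

If the nonnegativity set \<open>S\<close> of the leading components of the generators is Zariski dense, then the
leading component of every element of the quadratic module is nonnegative on \<open>S\<close>. If two such leading
components cancelled, both would vanish on \<open>S\<close>, hence be zero. So no cancellation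
occurs and the module is totally stable (\<open>totally_stable_if_dense\<close>).

Conversely, if \<open>M\<close> is totally stable and closed under multiplication, the polynomials whose leading component is
one of an element of \<open>M\<close> form, together with \<open>0\<close>, a cone \<open>N\<close> which is closed under addition and
multiplication, contains all squares, and satisfies \<open>N \<inter> - N = {0}\<close>. It contains the leading components
of the generators and, for any \<open>p \<noteq> 0\<close>, the square \<open>p\<^sup>2\<close>. It then suffices to find a real point at
which these finitely many nonzero elements of \<open>N\<close> are all positive: \<open>p\<close> does not vanish at this
point of \<open>S\<close>, and as \<open>p\<close> was arbitrary \<open>S\<close> is dense (\<open>dense_if_totally_stable\<close>).

The existence of that real point (\<open>pointed_cone_positive_point\<close>) is a form of the Artin-Lang theorem
and contains Artin's solution of Hilbert's seventeenth problem. By Zorn's lemma, \<open>N\<close>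
extends to a maximal cone in an algebraic closure of the field of rational functions.
Maximality makes the field it spans totally ordered (\<open>max_cone_total\<close>) and real closed
(\<open>witness_field_root_between\<close>), and in this field the variables form a point where the given polynomials are positive.
(As a type cannot depend on \<open>N\<close>, the last two facts are proved
for the field of one cone, chosen to be a counterexample to the claim if there is one.)
Finally, sign conditions descend from any real closed extension to the reals. Variables are replaced one by one, and for one
variable (\<open>one_variable_transfer\<close>) sign tables over the two fields are matched in the manner of Cohen
and Hormander, adding polynomials in order of increasing degree: between neighbouring points of
the table the derivative has constant sign, so a new polynomial has at most one root there,
and whether it has one is decided by its signs at the ends, which are signs of pseudo-remainders.\<close>

section \<open>Real closed fields\<close>

text \<open>Fields with the intermediate value property for polynomials. The axiom speaks of finite power sums
  because the type of polynomials over the class type is not available inside the class; the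
  formulation for polynomials follows as \<open>root_between_neg_pos\<close>.\<close>

class real_closed_field = linordered_field +
  assumes intermediate_value:
    "a < b \<Longrightarrow> (\<Sum>k\<le>n. f k * a ^ k) < 0 \<Longrightarrow> (\<Sum>k\<le>n. f k * b ^ k) > 0 \<Longrightarrow>
      \<exists>x. a < x \<and> x < b \<and> (\<Sum>k\<le>n. f k * x ^ k) = 0"

instance real :: real_closed_field
proof
  fix a b :: real and n :: nat and f :: "nat \<Rightarrow> real"
  assume ab: "a < b" "(\<Sum>k\<le>n. f k * a ^ k) < 0" "(\<Sum>k\<le>n. f k * b ^ k) > 0"
  have "\<exists>x. a \<le> x \<and> x \<le> b \<and> (\<Sum>k\<le>n. f k * x ^ k) = 0"
    by (rule IVT') (use ab in \<open>auto intro!: continuous_intros\<close>)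
  then obtain x where "a \<le> x" "x \<le> b" "(\<Sum>k\<le>n. f k * x ^ k) = 0" by blast
  moreover from this ab have "x \<noteq> a" "x \<noteq> b" by auto
  ultimately show "\<exists>x. a < x \<and> x < b \<and> (\<Sum>k\<le>n. f k * x ^ k) = 0"
    by (metis order_le_less)
qed

lemma root_between_neg_pos:
  fixes p :: "'a::real_closed_field poly"
  assumes "a < b" "poly p a < 0" "poly p b > 0"
  obtains x where "a < x" "x < b" "poly p x = 0"
  using intermediate_value[of a b "coeff p" "degree p"] assms by (auto simp: poly_altdef)

lemma root_between_sign_change:
  fixes p :: "'a::real_closed_field poly"
  assumes "a < b" "poly p a * poly p b < 0"
  obtains x where "a < x" "x < b" "poly p x = 0"
proof (cases "poly p a < 0")
  case True
  with assms show ?thesis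
    using root_between_neg_pos[of a b p] that by (auto simp: mult_less_0_iff)
next
  case False
  with assms show ?thesis
    using root_between_neg_pos[of a b "- p"] that by (auto simp: mult_less_0_iff)
qed

lemma factor_out_root:
  fixes p :: "'a::idom poly"
  assumes "p \<noteq> 0" "poly p a = 0"
  obtains m q where "p = [:- a, 1:] ^ Suc m * q" "poly q a \<noteq> 0"
proof -
  obtain q where q: "p = [:- a, 1:] ^ order a p * q" "\<not> [:- a, 1:] dvd q"
    using order_decomp[OF assms(1)] by blast
  moreover have "order a p \<noteq> 0" using assms by (simp add: order_root)
  ultimately show ?thesis
    using that[of "order a p - 1" q] by (simp add: poly_eq_0_iff_dvd)
qed

lemma smult_conv_mult: "smult c p = [:c:] * p"
  by simp

text \<open>Between consecutive roots \<open>a < b\<close> write \<open>p = (x - a)^(m+1) (x - b)^(n+1) r\<close>. Then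
  \<open>p' = (x - a)^m (x - b)^n w\<close>, and \<open>w(a)\<close>, \<open>w(b)\<close> have opposite signs because \<open>r\<close>
  keeps its sign on \<open>[a, b]\<close>. This argument only uses intermediate values and no compactness.\<close>

lemma rolle_consecutive:
  fixes p :: "'a::real_closed_field poly"
  assumes "p \<noteq> 0" "a < b" "poly p a = 0" "poly p b = 0"
    and none: "\<And>x. a < x \<Longrightarrow> x < b \<Longrightarrow> poly p x \<noteq> 0"
  shows "\<exists>x. a < x \<and> x < b \<and> poly (pderiv p) x = 0"
proof -
  obtain m q where q: "p = [:- a, 1:] ^ Suc m * q" "poly q a \<noteq> 0"
    using factor_out_root assms by metis
  then have "q \<noteq> 0" "poly q b = 0" using assms by auto
  then obtain n r where r: "q = [:- b, 1:] ^ Suc n * r" "poly r b \<noteq> 0"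
    using factor_out_root by metis
  have ra: "poly r a \<noteq> 0" using q r by auto
  have rr: "poly r a * poly r b > 0"
  proof (rule ccontr)
    assume "\<not> ?thesis"
    then have "poly r a * poly r b < 0" using ra r(2) by (simp add: order_less_le)
    then obtain x where "a < x" "x < b" "poly r x = 0"
      using root_between_sign_change assms(2) by blast
    then show False using none[of x] by (simp add: q r)
  qed
  define w where "w = smult (of_nat (Suc m)) ([:- b, 1:] * r) + smult (of_nat (Suc n)) ([:- a, 1:] * r)
    + [:- a, 1:] * [:- b, 1:] * pderiv r"
  have pd: "pderiv p = [:- a, 1:] ^ m * [:- b, 1:] ^ n * w"
  proof -
    have lin: "pderiv [:- x, 1 :: 'a:] = 1" for x by (simp add: pderiv_pCons one_pCons)
    show ?thesis
      unfolding q r w_def pderiv_mult pderiv_power_Suc lin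
      by (simp only: power_Suc smult_conv_mult mult_1_right) (simp only: algebra_simps)
  qed
  have "poly w a * poly w b = of_nat (Suc m) * of_nat (Suc n) * ((a - b) * (b - a)) * (poly r a * poly r b)"
    by (simp add: w_def algebra_simps del: of_nat_Suc)
  also have "\<dots> < 0"
  proof -
    have neg: "(a - b) * (b - a) < 0" using assms(2) by (simp add: mult_neg_pos)
    have "(of_nat (Suc m) * of_nat (Suc n) :: 'a) > 0" by (simp del: of_nat_Suc)
    from mult_neg_pos[OF mult_pos_neg[OF this neg] rr] show ?thesis .
  qed
  finally obtain x where "a < x" "x < b" "poly w x = 0"
    using root_between_sign_change assms(2) by blast
  then show ?thesis by (auto simp: pd)
qed

lemma rolle:
  fixes p :: "'a::real_closed_field poly"
  assumes "a < b" "poly p a = 0" "poly p b = 0"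
  shows "\<exists>x. a < x \<and> x < b \<and> poly (pderiv p) x = 0"
proof (cases "p = 0")
  case True
  then show ?thesis using dense[OF assms(1)] by auto
next
  case False
  \<comment> \<open>The first root after a reduces the claim to consecutive roots.\<close>
  define R where "R = {x. a < x \<and> x \<le> b \<and> poly p x = 0}"
  have R: "finite R" "b \<in> R"
    using poly_roots_finite[OF False] assms unfolding R_def
    by (auto elim: rev_finite_subset)
  define c where "c = Min R"
  have c: "c \<in> R" "\<And>x. x \<in> R \<Longrightarrow> c \<le> x" 
    using Min_in[OF R(1)] Min_le[OF R(1)] R(2) unfolding c_def by blast+
  have none: "poly p x \<noteq> 0" if "a < x" "x < c" for x
  proof
    assume "poly p x = 0"
    then have "x \<in> R" using that c(1) by (simp add: R_def)
    then show False using c(2) that(2) by (simp add: not_less[symmetric])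
  qed
  have "\<exists>x. a < x \<and> x < c \<and> poly (pderiv p) x = 0"
    by (rule rolle_consecutive[OF False]) (use c(1) assms none in \<open>simp_all add: R_def\<close>)
  then show ?thesis using c by (auto simp: R_def intro: less_le_trans)
qed

lemma mean_value:
  fixes p :: "'a::real_closed_field poly"
  assumes "a < b"
  obtains x where "a < x" "x < b" "poly p b - poly p a = (b - a) * poly (pderiv p) x"
proof -
  define s where "s = (poly p b - poly p a) / (b - a)"
  \<comment> \<open>Subtracting the chord through the end points leaves a polynomial with roots there.\<close>
  define q where "q = p - [:poly p a - s * a, s:]"
  have "b - a \<noteq> 0" using assms by simp
  then have s: "s * (b - a) = poly p b - poly p a" by (simp add: s_def)
  have "poly q a = 0" "poly q b = 0" using s by (simp_all add: q_def algebra_simps)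
  from rolle[OF assms this] obtain x where "a < x" "x < b" "poly (pderiv q) x = 0" by blast
  then show ?thesis using that[of x] s by (simp add: q_def pderiv_diff pderiv_pCons mult.commute)
qed

lemma strictly_increasing:
  fixes p :: "'a::real_closed_field poly"
  assumes "a < b" "\<And>x. a < x \<Longrightarrow> x < b \<Longrightarrow> poly (pderiv p) x > 0"
  shows "poly p a < poly p b"
proof -
  obtain x where x: "a < x" "x < b" "poly p b - poly p a = (b - a) * poly (pderiv p) x"
    using mean_value[OF assms(1)] by blast
  then have "(b - a) * poly (pderiv p) x > 0" using assms by simp
  with x show ?thesis by simp
qed

text \<open>The uniform lower bound \<open>k\<close> makes the induction on the coefficients work: it is what dominates
  the next constant coefficient after multiplication by a large \<open>x\<close>.\<close>

lemma eventually_above_positive: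
  fixes p :: "'a::linordered_field poly"
  assumes "lead_coeff p > 0"
  shows "\<exists>B k. k > 0 \<and> (\<forall>x\<ge>B. poly p x \<ge> k)"
  using assms
proof (induction p)
  case 0
  then show ?case by simp
next
  case (pCons c p)
  show ?case
  proof (cases "p = 0")
    case True
    then show ?thesis using pCons.prems by auto
  next
    case False
    then obtain B k where Bk: "k > 0" "\<And>x. x \<ge> B \<Longrightarrow> poly p x \<ge> k"
      using pCons by auto
    show ?thesis
    proof (intro exI conjI allI impI)
      show "k > 0" by fact
      \<comment> \<open>Beyond this bound x * k is at least k + \<bar>c\<bar>.\<close>
      fix x assume x: "max B (1 + \<bar>c\<bar> / k) \<le> x"
      then have "x \<ge> 0" using Bk(1) by (auto intro: order_trans[rotated])
      have "k + \<bar>c\<bar> = (1 + \<bar>c\<bar> / k) * k" using Bk(1) by (simp add: field_simps)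
      also have "\<dots> \<le> x * k" using x Bk(1) by (intro mult_right_mono) auto
      also have "\<dots> \<le> x * poly p x" using Bk(2)[of x] x \<open>x \<ge> 0\<close> by (intro mult_left_mono) auto
      finally show "k \<le> poly (pCons c p) x" by simp
    qed
  qed
qed

lemma positive_far_right:
  fixes p :: "'a::linordered_field poly"
  assumes "lead_coeff p > 0"
  obtains x where "x > y" "poly p x > 0"
proof -
  obtain B k where "k > 0" "\<And>x. x \<ge> B \<Longrightarrow> poly p x \<ge> k"
    using eventually_above_positive[OF assms] by blast
  from this(1) this(2)[of "max B (y + 1)"] have "poly p (max B (y + 1)) > 0" by auto
  then show ?thesis using that[of "max B (y + 1)"] by auto
qed

section \<open>Cuts of two ordered fields\<close>

text \<open>The library's \<open>sgn\<close> takes its values in the field itself, so signs in two different fields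
  cannot be compared through it.\<close>

definition same_sign :: "'a::linordered_idom \<Rightarrow> 'b::linordered_idom \<Rightarrow> bool" where
  "same_sign a b \<longleftrightarrow> (0 < a \<longleftrightarrow> 0 < b) \<and> (a < 0 \<longleftrightarrow> b < 0)"

lemma same_sign_zero: "same_sign a b \<Longrightarrow> a = 0 \<longleftrightarrow> b = 0"
  unfolding same_sign_def by (metis linorder_neqE less_irrefl)

lemma same_sign_minus [simp]: "same_sign (- a) (- b) \<longleftrightarrow> same_sign a b"
  by (auto simp: same_sign_def)

lemma same_sign_sym: "same_sign a b \<longleftrightarrow> same_sign b a"
  by (auto simp: same_sign_def)

lemma same_sign_0_0 [simp]: "same_sign 0 0"
  by (simp add: same_sign_def)

lemma same_sign_mult: "same_sign a b \<Longrightarrow> same_sign c d \<Longrightarrow> same_sign (a * c) (b * d)"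
  by (auto simp: same_sign_def zero_less_mult_iff mult_less_0_iff)

lemma same_sign_1_1 [simp]: "same_sign 1 1"
  by (simp add: same_sign_def)

lemma same_sign_power: "same_sign a b \<Longrightarrow> same_sign (a ^ n) (b ^ n)"
  by (induction n) (auto intro: same_sign_mult)

lemma same_sign_mult_cancel:
  assumes "same_sign (a * c) (b * d)" "same_sign a b" "a \<noteq> 0"
  shows "same_sign c d"
proof (cases "a > 0")
  case True
  then show ?thesis using assms by (simp add: same_sign_def zero_less_mult_iff mult_less_0_iff not_less_iff_gr_or_eq)
next
  case False
  then have "a < 0" using assms by simp
  then show ?thesis using assms by (simp add: same_sign_def zero_less_mult_iff mult_less_0_iff not_less_iff_gr_or_eq)
qed

text \<open>A finite set \<open>\<rho>\<close> of pairs lists corresponding points in two ordered fields. The points \<open>y\<close> and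
  \<open>y'\<close> match when they lie in the same way between, or on, the listed points; no bijection or
  enumeration of the points has to be carried along.\<close>

definition same_cut :: "('a::linorder \<times> 'b::linorder) set \<Rightarrow> 'a \<Rightarrow> 'b \<Rightarrow> bool" where
  "same_cut \<rho> y y' \<longleftrightarrow> (\<forall>(z, z')\<in>\<rho>. (y < z \<longleftrightarrow> y' < z') \<and> (z < y \<longleftrightarrow> z' < y'))"

text \<open>Stated through \<open>same_cut\<close>, which at once makes \<open>\<rho>\<close> the graph of a strictly increasing
  bijection between its domain and its range.\<close>

definition increasing_pairs :: "('a::linorder \<times> 'b::linorder) set \<Rightarrow> bool" where
  "increasing_pairs \<rho> \<longleftrightarrow> (\<forall>(a, a')\<in>\<rho>. same_cut \<rho> a a')"

text \<open>For finite increasing \<open>\<rho>\<close> and nonzero \<open>p\<close> this forces every root of \<open>p\<close> to be a listed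
  point: all points of an open cut match the same points on the other side, so \<open>p\<close> would vanish on
  the whole cut.\<close>

definition consistent ::
  "('a::linordered_idom \<times> 'b::linordered_idom) set \<Rightarrow> 'a poly \<Rightarrow> 'b poly \<Rightarrow> bool" where
  "consistent \<rho> p p' \<longleftrightarrow> (\<forall>y y'. same_cut \<rho> y y' \<longrightarrow> same_sign (poly p y) (poly p' y'))"

lemma same_cut_converse [simp]: "same_cut (\<rho>\<inverse>) y' y \<longleftrightarrow> same_cut \<rho> y y'"
  unfolding same_cut_def by blast

lemma increasing_pairs_converse [simp]: "increasing_pairs (\<rho>\<inverse>) \<longleftrightarrow> increasing_pairs \<rho>"
  by (auto simp: increasing_pairs_def)

lemma consistent_converse [simp]: "consistent (\<rho>\<inverse>) p' p \<longleftrightarrow> consistent \<rho> p p'"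
  unfolding consistent_def same_cut_converse using same_sign_sym by blast

lemma same_cut_pairD:
  assumes "same_cut \<rho> y y'" "(z, z') \<in> \<rho>"
  shows "y < z \<longleftrightarrow> y' < z'" "z < y \<longleftrightarrow> z' < y'" "y = z \<longleftrightarrow> y' = z'"
proof -
  show 1: "y < z \<longleftrightarrow> y' < z'" "z < y \<longleftrightarrow> z' < y'"
    using assms by (auto simp: same_cut_def)
  show "y = z \<longleftrightarrow> y' = z'" using 1 by (metis linorder_neqE less_irrefl)
qed

lemma increasing_pairsD: "increasing_pairs \<rho> \<Longrightarrow> (a, a') \<in> \<rho> \<Longrightarrow> same_cut \<rho> a a'"
  by (auto simp: increasing_pairs_def)

lemma consistentD: "consistent \<rho> p p' \<Longrightarrow> same_cut \<rho> y y' \<Longrightarrow> same_sign (poly p y) (poly p' y')"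
  by (simp add: consistent_def)

text \<open>Density and the absence of endpoints are all that is needed to realise a finite cut.\<close>

lemma exists_between_finite:
  fixes L U :: "'a::unbounded_dense_linorder set"
  assumes "finite L" "finite U" "\<And>l u. l \<in> L \<Longrightarrow> u \<in> U \<Longrightarrow> l < u"
  shows "\<exists>y. (\<forall>l\<in>L. l < y) \<and> (\<forall>u\<in>U. y < u)"
proof (cases "L = {}"; cases "U = {}")
  assume "L = {}" "U \<noteq> {}"
  then show ?thesis using lt_ex[of "Min U"] assms by auto
next
  assume "L \<noteq> {}" "U = {}"
  then show ?thesis using gt_ex[of "Max L"] assms by auto
next
  assume LU: "L \<noteq> {}" "U \<noteq> {}"
  then have "Max L < Min U" using assms by simp
  then obtain y where "Max L < y" "y < Min U" using dense by blast
  then show ?thesis using LU assms by auto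
qed auto

lemma same_cut_exists:
  fixes \<rho> :: "('a::linorder \<times> 'b::unbounded_dense_linorder) set"
  assumes "finite \<rho>" "increasing_pairs \<rho>"
  shows "\<exists>y'. same_cut \<rho> y y'"
proof (cases "\<exists>z'. (y, z') \<in> \<rho>")
  case True
  then show ?thesis using assms increasing_pairsD by blast
next
  case False
  define L where "L = {z'. \<exists>z. (z, z') \<in> \<rho> \<and> z < y}"
  define U where "U = {z'. \<exists>z. (z, z') \<in> \<rho> \<and> y < z}"
  have "L \<subseteq> snd ` \<rho>" "U \<subseteq> snd ` \<rho>" unfolding L_def U_def by force+
  then have fin: "finite L" "finite U" using assms(1) by (auto intro: finite_subset)
  have "\<exists>y'. (\<forall>l\<in>L. l < y') \<and> (\<forall>u\<in>U. y' < u)"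
  proof (rule exists_between_finite[OF fin])
    fix l u assume "l \<in> L" "u \<in> U"
    then obtain a b where "(a, l) \<in> \<rho>" "a < y" "(b, u) \<in> \<rho>" "y < b" by (auto simp: L_def U_def)
    then show "l < u"
      using same_cut_pairD(1)[OF increasing_pairsD[OF assms(2)], of a l b u] by auto
  qed
  then obtain y' where y': "\<forall>l\<in>L. l < y'" "\<forall>u\<in>U. y' < u" by blast
  have "same_cut \<rho> y y'"
    unfolding same_cut_def
  proof safe
    fix z z' assume z: "(z, z') \<in> \<rho>"
    then have "z < y \<or> y < z" using False by (metis linorder_neqE)
    then have "(z < y \<and> z' < y') \<or> (y < z \<and> y' < z')" using y' z by (auto simp: L_def U_def)
    then show "y < z \<Longrightarrow> y' < z'" "y' < z' \<Longrightarrow> y < z" "z < y \<Longrightarrow> z' < y'" "z' < y' \<Longrightarrow> z < y"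
      by auto
  qed
  then show ?thesis by blast
qed

section \<open>Adding the roots of one more polynomial\<close>

text \<open>The hypotheses under which a diagram \<open>\<rho>\<close> that already controls the derivative of \<open>p\<close> can be
  refined to control \<open>p\<close>: the signs of \<open>p\<close> at the listed points and at infinity agree as well.\<close>

definition extendable ::
  "('a::real_closed_field \<times> 'b::real_closed_field) set \<Rightarrow> 'a poly \<Rightarrow> 'b poly \<Rightarrow> bool" where
  "extendable \<rho> p p' \<longleftrightarrow>
     finite \<rho> \<and> increasing_pairs \<rho> \<and> consistent \<rho> (pderiv p) (pderiv p') \<and>
     (\<forall>(z, z')\<in>\<rho>. same_sign (poly p z) (poly p' z')) \<and>
     same_sign (lead_coeff p) (lead_coeff p') \<and> degree p = degree p' \<and> degree p > 0"

lemma extendableD: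
  assumes "extendable \<rho> p p'"
  shows "finite \<rho>" "increasing_pairs \<rho>" "consistent \<rho> (pderiv p) (pderiv p')"
    "\<And>z z'. (z, z') \<in> \<rho> \<Longrightarrow> same_sign (poly p z) (poly p' z')"
    "same_sign (lead_coeff p) (lead_coeff p')" "degree p = degree p'" "degree p > 0"
  using assms by (auto simp: extendable_def)

lemma extendable_converse: "extendable \<rho> p p' \<Longrightarrow> extendable (\<rho>\<inverse>) p' p"
  unfolding extendable_def using same_sign_sym by force

lemma extendable_uminus: "extendable \<rho> p p' \<Longrightarrow> extendable \<rho> (- p) (- p')"
  by (auto simp: extendable_def consistent_def pderiv_minus)

lemma same_cut_mirror:
  fixes \<rho> :: "('a::linordered_ab_group_add \<times> 'b::linordered_ab_group_add) set"
  shows "same_cut ((\<lambda>(z, z'). (- z, - z')) ` \<rho>) y y' \<longleftrightarrow> same_cut \<rho> (- y) (- y')"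
  by (fastforce simp: same_cut_def less_minus_iff minus_less_iff)

lemma pderiv_mirror:
  "pderiv (pcompose p [:0, - 1:]) = - pcompose (pderiv p) [:0, - 1 :: 'a::idom:]"
  by (simp add: pderiv_pcompose pderiv_pCons)

text \<open>The reflection \<open>x \<mapsto> - x\<close> combined with a change of sign keeps the derivative's sign; statements
  about the left end of a cut are thereby reduced to the right end.\<close>

lemma extendable_mirror:
  assumes "extendable \<rho> p p'"
  shows "extendable ((\<lambda>(z, z'). (- z, - z')) ` \<rho>) (- pcompose p [:0, - 1:]) (- pcompose p' [:0, - 1:])"
proof -
  note D = assms[unfolded extendable_def]
  let ?q = "pcompose p [:0, - 1:]" and ?q' = "pcompose p' [:0, - 1:]"
  have "increasing_pairs ((\<lambda>(z, z'). (- z, - z')) ` \<rho>)"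
    using D by (auto simp: increasing_pairs_def same_cut_mirror)
  moreover have "consistent ((\<lambda>(z, z'). (- z, - z')) ` \<rho>) (pderiv (- ?q)) (pderiv (- ?q'))"
    using D by (simp add: consistent_def same_cut_mirror pderiv_minus pderiv_mirror poly_pcompose)
  moreover have "\<forall>(z, z')\<in>(\<lambda>(z, z'). (- z, - z')) ` \<rho>. same_sign (poly (- ?q) z) (poly (- ?q') z')"
    using D by (auto simp: poly_pcompose)
  moreover have "same_sign (lead_coeff ?q) (lead_coeff ?q')"
  proof -
    have "same_sign (lead_coeff p * (- 1) ^ degree p) (lead_coeff p' * (- 1) ^ degree p)"
      by (intro same_sign_mult extendableD(5)[OF assms] same_sign_power) (simp add: same_sign_def)
    then show ?thesis using extendableD(6)[OF assms] by (simp add: lead_coeff_comp)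
  qed
  moreover have "degree (- ?q) = degree (- ?q')" "degree (- ?q) > 0"
    using D by (simp_all add: degree_pcompose)
  ultimately show ?thesis using D by (simp add: extendable_def)
qed

lemma same_cut_move_right:
  assumes "same_cut \<rho> y y'" "y \<le> x" "\<And>w w'. (w, w') \<in> \<rho> \<Longrightarrow> w < y \<or> x < w"
  shows "same_cut \<rho> x y'"
  unfolding same_cut_def
proof (intro ballI, clarsimp)
  fix w w' assume w: "(w, w') \<in> \<rho>"
  show "(x < w \<longleftrightarrow> y' < w') \<and> (w < x \<longleftrightarrow> w' < y')"
    using assms(3)[OF w] same_cut_pairD[OF assms(1) w] assms(2) by auto
qed

lemma same_cut_off_points:
  assumes "same_cut \<rho> y y'" "y \<notin> Domain \<rho>" "(w, w') \<in> \<rho>"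
  shows "(w < y \<and> w' < y') \<or> (y < w \<and> y' < w')"
  using same_cut_pairD[OF assms(1,3)] assms(2,3) by (metis Domain.intros linorder_neqE)

text \<open>If the derivative vanished at one point of an open cut then, by consistency, it would vanish on
  infinitely many points and be the zero polynomial.\<close>

lemma derivative_nonzero_in_cut:
  assumes "extendable \<rho> p p'" "same_cut \<rho> y y'" "y \<notin> Domain \<rho>"
  shows "poly (pderiv p) y \<noteq> 0"
proof
  assume 0: "poly (pderiv p) y = 0"
  have fin: "finite (Domain \<rho>)" using assms(1) by (simp add: extendable_def finite_Domain)
  have "\<exists>u. (\<forall>l\<in>{y}. l < u) \<and> (\<forall>z\<in>{z \<in> Domain \<rho>. y < z}. u < z)"
    by (rule exists_between_finite) (use fin in auto)
  then obtain u where u: "y < u" "\<And>z. z \<in> Domain \<rho> \<Longrightarrow> y < z \<Longrightarrow> u < z" by auto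
  have cons: "consistent \<rho> (pderiv p) (pderiv p')" using assms(1) by (simp add: extendable_def)
  have "poly (pderiv p') y' = 0"
    using cons assms(2) 0 by (auto simp: consistent_def dest: same_sign_zero)
  moreover have "same_cut \<rho> x y'" if "x \<in> {y<..<u}" for x
  proof (rule same_cut_move_right[OF assms(2)])
    show "y \<le> x" using that by simp
    show "w < y \<or> x < w" if "(w, w') \<in> \<rho>" for w w'
      using u(2)[of w] that \<open>x \<in> {y<..<u}\<close> assms(3)
      by (metis Domain.intros greaterThanLessThan_iff less_trans linorder_neqE)
  qed
  ultimately have "{y<..<u} \<subseteq> {x. poly (pderiv p) x = 0}"
    using same_sign_zero[OF consistentD[OF cons]] by blast
  moreover have "infinite {y<..<u}" using u(1) by (simp add: infinite_Ioo)
  ultimately have "pderiv p = 0" using poly_roots_finite infinite_super by blast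
  then show False using assms(1) by (simp add: extendable_def pderiv_eq_0_iff)
qed

text \<open>On the cut of \<open>y\<close> the polynomial \<open>p\<close> increases, so it is positive at the right end of the cut, be
  this a listed point or infinity. The sign at that end is shared by \<open>p'\<close>, which is negative at
  \<open>y'\<close>, and the intermediate value property yields a root.\<close>

lemma root_right_of:
  fixes \<rho> :: "('a::real_closed_field \<times> 'b::real_closed_field) set"
  assumes ext: "extendable \<rho> p p'" and cut: "same_cut \<rho> y y'" and y: "y \<notin> Domain \<rho>"
    and incr: "poly (pderiv p) y > 0" and sgn: "poly p y \<ge> 0" "poly p' y' < 0"
  obtains c' where "y' < c'" "same_cut \<rho> y c'" "poly p' c' = 0"
proof -
  note D = ext[unfolded extendable_def]
  have der: "poly (pderiv p) x > 0"
    if "y \<le> x" "\<And>w w'. (w, w') \<in> \<rho> \<Longrightarrow> w < y \<or> x < w" for x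
  proof -
    have "same_cut \<rho> x y'" using same_cut_move_right[OF cut] that by blast
    then show ?thesis
      using consistentD[of \<rho> "pderiv p" "pderiv p'" _ y'] D cut incr by (simp add: same_sign_def)
  qed
  note off = same_cut_off_points[OF cut y]
  define U where "U = {z \<in> Domain \<rho>. y < z}"
  have finU: "finite U" using D by (simp add: U_def finite_Domain)
  have "\<exists>b'. y' < b' \<and> poly p' b' > 0 \<and> (\<forall>w w'. (w, w') \<in> \<rho> \<longrightarrow> y < w \<longrightarrow> b' \<le> w')"
  proof (cases "U = {}")
    case True
    have "lead_coeff p > 0"
    proof (rule ccontr)
      assume "\<not> lead_coeff p > 0"
      then have "lead_coeff (- p) > 0" using D leading_coeff_0_iff[of p] by (auto simp: not_less order_le_less)
      then obtain x where x: "x > y" "poly (- p) x > 0" using positive_far_right by blast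
      have "poly p y < poly p x"
        by (rule strictly_increasing[OF x(1)], rule der)
          (use True off in \<open>auto simp: U_def\<close>)
      then show False using x sgn by simp
    qed
    then have "lead_coeff p' > 0" using extendableD(5)[OF ext] by (simp only: same_sign_def)
    then obtain b' where "b' > y'" "poly p' b' > 0" using positive_far_right by blast
    then show ?thesis using True by (auto simp: U_def)
  next
    case False
    define z where "z = Min U"
    have z: "z \<in> U" "\<And>w. w \<in> U \<Longrightarrow> z \<le> w" using False finU by (auto simp: z_def)
    then obtain z' where z': "(z, z') \<in> \<rho>" "y < z" by (auto simp: U_def)
    have "poly p y < poly p z"
      by (rule strictly_increasing[OF z'(2)], rule der)
        (use z off in \<open>force simp: U_def\<close>)+
    then have "poly p' z' > 0" using D z' sgn by (auto simp: same_sign_def)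
    moreover have "y' < z'" using off[OF z'(1)] z'(2) by auto
    moreover have "z' \<le> w'" if "(w, w') \<in> \<rho>" "y < w" for w w'
    proof -
      have "z \<le> w" using z(2)[of w] that by (auto simp: U_def)
      moreover have "same_cut \<rho> w w'" using D that by (simp add: increasing_pairsD)
      ultimately show ?thesis using same_cut_pairD(1)[of \<rho> w w' z z'] z'(1) by (simp add: not_less[symmetric])
    qed
    ultimately show ?thesis by blast
  qed
  then obtain b' where b': "y' < b'" "poly p' b' > 0"
    "\<And>w w'. (w, w') \<in> \<rho> \<Longrightarrow> y < w \<Longrightarrow> b' \<le> w'" by blast
  obtain c' where c': "y' < c'" "c' < b'" "poly p' c' = 0"
    using root_between_neg_pos[of y' b' p'] b' sgn by blast
  have "same_cut \<rho> y c'"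
    unfolding same_cut_def
  proof (intro ballI, clarsimp)
    fix w w' assume w: "(w, w') \<in> \<rho>"
    show "(y < w \<longleftrightarrow> c' < w') \<and> (w < y \<longleftrightarrow> w' < c')"
      using off[OF w] b'(3)[OF w] c' by auto
  qed
  then show ?thesis using that c' by blast
qed

lemma root_left_of:
  fixes \<rho> :: "('a::real_closed_field \<times> 'b::real_closed_field) set"
  assumes ext: "extendable \<rho> p p'" and cut: "same_cut \<rho> y y'" and y: "y \<notin> Domain \<rho>"
    and incr: "poly (pderiv p) y > 0" and sgn: "poly p y \<le> 0" "poly p' y' > 0"
  obtains c' where "c' < y'" "same_cut \<rho> y c'" "poly p' c' = 0"
proof -
  let ?\<rho> = "(\<lambda>(z, z'). (- z, - z')) ` \<rho>"
  obtain c' where "- y' < c'" "same_cut ?\<rho> (- y) c'" "poly (- pcompose p' [:0, - 1:]) c' = 0"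
    by (rule root_right_of[OF extendable_mirror[OF ext], of "- y" "- y'"])
      (use cut y incr sgn in \<open>auto simp: same_cut_mirror poly_pcompose pderiv_minus pderiv_mirror\<close>)
  then show ?thesis using that[of "- c'"] by (simp add: same_cut_mirror poly_pcompose minus_less_iff)
qed

text \<open>Whatever the sign of \<open>p'\<close> at a point of the cut of \<open>c\<close>, a root lies on one of its two sides,
  because \<open>p\<close> vanishes at \<open>c\<close> and is therefore negative at one end of the cut and positive at
  the other.\<close>

lemma matching_root:
  fixes \<rho> :: "('a::real_closed_field \<times> 'b::real_closed_field) set"
  assumes ext: "extendable \<rho> p p'" and root: "poly p c = 0"
  obtains c' where "same_cut \<rho> c c'" "poly p' c' = 0"
proof -
  note D = ext[unfolded extendable_def]
  obtain y' where cut: "same_cut \<rho> c y'" using same_cut_exists D by blast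
  show ?thesis
  proof (cases "c \<in> Domain \<rho>")
    case True
    then obtain c' where "(c, c') \<in> \<rho>" by blast
    then have "same_cut \<rho> c c'" "same_sign (poly p c) (poly p' c')"
      using extendableD[OF ext] increasing_pairsD by blast+
    then show ?thesis using that[of c'] root same_sign_zero by auto
  next
    case False
    have main: "\<exists>c'. same_cut \<rho> c c' \<and> poly q' c' = 0"
      if q: "extendable \<rho> q q'" "poly q c = 0" "poly (pderiv q) c > 0" for q q'
    proof (cases "poly q' y'" "0 :: 'b" rule: linorder_cases)
      case less
      then show ?thesis using root_right_of[OF q(1) cut False q(3)] q(2) by (metis order_refl)
    next
      case greater
      then show ?thesis using root_left_of[OF q(1) cut False q(3)] q(2) by (metis order_refl)
    qed (use cut in blast)
    have "poly (pderiv p) c \<noteq> 0" using derivative_nonzero_in_cut[OF ext cut False] .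
    then consider "poly (pderiv p) c > 0" | "poly (pderiv (- p)) c > 0"
      by (metis linorder_neqE neg_0_less_iff_less pderiv_minus poly_minus)
    then show ?thesis
      using main[OF ext root] main[OF extendable_uminus[OF ext]] root that by cases auto
  qed
qed

text \<open>The derivative has constant sign on an open cut. This gives uniqueness of roots in a cut and
  determines the sign of \<open>p\<close> at points of the cut before a root.\<close>

lemma monotone_in_cut:
  fixes \<rho> :: "('a::real_closed_field \<times> 'b::real_closed_field) set"
  assumes ext: "extendable \<rho> p p'" and cut: "same_cut \<rho> y y'" "same_cut \<rho> x y'"
    and y: "y \<notin> Domain \<rho>" and "y < x"
  shows "poly (pderiv p) y > 0 \<Longrightarrow> poly p y < poly p x"
    and "poly (pderiv p) y < 0 \<Longrightarrow> poly p x < poly p y"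
proof -
  note D = ext[unfolded extendable_def]
  have cut': "same_cut \<rho> u y'" if "y < u" "u < x" for u
    by (rule same_cut_move_right[OF cut(1)])
      (use that same_cut_off_points[OF cut(1) y] same_cut_pairD[OF cut(2)] in \<open>force\<close>)+
  have same: "same_sign (poly (pderiv p) u) (poly (pderiv p) y)" if "y < u" "u < x" for u
    using cut'[OF that] cut(1) D by (auto simp: consistent_def same_sign_def)
  show "poly p y < poly p x" if "poly (pderiv p) y > 0"
    by (rule strictly_increasing[OF \<open>y < x\<close>]) (use same that in \<open>auto simp: same_sign_def\<close>)
  show "poly p x < poly p y" if "poly (pderiv p) y < 0"
    using strictly_increasing[OF \<open>y < x\<close>, of "- p"] same that
    by (auto simp: same_sign_def pderiv_minus)
qed

lemma root_unique_in_cut: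
  fixes \<rho> :: "('a::real_closed_field \<times> 'b::real_closed_field) set"
  assumes ext: "extendable \<rho> p p'" and cut: "same_cut \<rho> c y'" "same_cut \<rho> d y'"
    and roots: "poly p c = 0" "poly p d = 0"
  shows "c = d"
proof -
  have *: False if c: "same_cut \<rho> c y'" "same_cut \<rho> d y'" "poly p c = 0" "poly p d = 0" "c < d" for c d
  proof (cases "c \<in> Domain \<rho>")
    case True
    then obtain z' where "(c, z') \<in> \<rho>" by blast
    then show False using same_cut_pairD[OF c(1), of c z'] same_cut_pairD[OF c(2), of c z'] c(5) by auto
  next
    case False
    then show False
      using monotone_in_cut[OF ext c(1,2) False c(5)] derivative_nonzero_in_cut[OF ext c(1) False] c(3,4)
      by (metis less_irrefl linorder_neqE)
  qed
  show ?thesis using *[of c d] *[of d c] cut roots by (metis linorder_neqE)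
qed

text \<open>All matching pairs of roots can be taken at once: within a cut each side has at most one root.\<close>

definition root_pairs ::
  "('a::real_closed_field \<times> 'b::real_closed_field) set \<Rightarrow> 'a poly \<Rightarrow> 'b poly \<Rightarrow> ('a \<times> 'b) set" where
  "root_pairs \<rho> p p' = {(c, c'). same_cut \<rho> c c' \<and> poly p c = 0 \<and> poly p' c' = 0}"

lemma root_pairs_converse: "root_pairs (\<rho>\<inverse>) p' p = (root_pairs \<rho> p p')\<inverse>"
  by (auto simp: root_pairs_def)

lemma root_pairs_uminus: "root_pairs \<rho> (- p) (- p') = root_pairs \<rho> p p'"
  by (simp add: root_pairs_def)

lemma finite_root_pairs: "p \<noteq> 0 \<Longrightarrow> p' \<noteq> 0 \<Longrightarrow> finite (root_pairs \<rho> p p')"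
  by (rule finite_subset[of _ "{x. poly p x = 0} \<times> {x. poly p' x = 0}"])
    (auto simp: root_pairs_def poly_roots_finite)

lemma same_cut_Un: "same_cut (\<rho> \<union> \<sigma>) y y' \<longleftrightarrow> same_cut \<rho> y y' \<and> same_cut \<sigma> y y'"
  by (auto simp: same_cut_def)

lemma root_pairs_less:
  fixes \<rho> :: "('a::real_closed_field \<times> 'b::real_closed_field) set"
  assumes ext: "extendable \<rho> p p'" and cd: "(c, c') \<in> root_pairs \<rho> p p'" "(d, d') \<in> root_pairs \<rho> p p'"
    and "c < d"
  shows "c' < d'"
proof (cases "same_cut \<rho> d c'")
  case True
  then show ?thesis using root_unique_in_cut[OF ext, of c c' d] cd \<open>c < d\<close> by (auto simp: root_pairs_def)
next
  case False
  have c: "same_cut \<rho> c c'" and d: "same_cut \<rho> d d'" using cd by (auto simp: root_pairs_def)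
  obtain z z' where z: "(z, z') \<in> \<rho>" "\<not> ((d < z \<longleftrightarrow> c' < z') \<and> (z < d \<longleftrightarrow> z' < c'))"
    using False by (auto simp: same_cut_def)
  then show ?thesis
    using same_cut_pairD[OF c z(1)] same_cut_pairD[OF d z(1)] \<open>c < d\<close> by force
qed

lemma increasing_Un_root_pairs:
  fixes \<rho> :: "('a::real_closed_field \<times> 'b::real_closed_field) set"
  assumes ext: "extendable \<rho> p p'"
  shows "increasing_pairs (\<rho> \<union> root_pairs \<rho> p p')"
proof -
  let ?R = "root_pairs \<rho> p p'"
  have inc: "increasing_pairs \<rho>" using ext by (simp add: extendable_def)
  have conv: "(c', c) \<in> root_pairs (\<rho>\<inverse>) p' p" if "(c, c') \<in> ?R" for c c'
    using that by (auto simp: root_pairs_def)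
  have R\<rho>: "same_cut \<rho> c c'" if "(c, c') \<in> ?R" for c c' using that by (auto simp: root_pairs_def)
  have RR: "same_cut ?R c c'" if "(c, c') \<in> ?R" for c c'
    unfolding same_cut_def
    using that root_pairs_less[OF ext] root_pairs_less[OF extendable_converse[OF ext]] conv by blast
  have \<rho>R: "same_cut ?R a a'" if "(a, a') \<in> \<rho>" for a a'
    unfolding same_cut_def using same_cut_pairD[OF R\<rho> that] by auto
  show ?thesis
    using inc R\<rho> RR \<rho>R by (auto simp: increasing_pairs_def same_cut_Un)
qed

text \<open>The step of the sign-table construction of Cohen and Hormander: once the roots of \<open>p\<close> and
  \<open>p'\<close> are listed, their signs agree on every cut. If they were opposite, one of the two
  polynomials would have a root further along in its cut, hence so would the other, and
  monotonicity would contradict the sign there.\<close>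

lemma consistent_Un_root_pairs:
  fixes \<rho> :: "('a::real_closed_field \<times> 'b::real_closed_field) set"
  assumes ext: "extendable \<rho> p p'"
  shows "consistent (\<rho> \<union> root_pairs \<rho> p p') p p'"
  unfolding consistent_def
proof (intro allI impI)
  fix y y' assume "same_cut (\<rho> \<union> root_pairs \<rho> p p') y y'"
  then have cut: "same_cut \<rho> y y'" and rcut: "same_cut (root_pairs \<rho> p p') y y'"
    by (auto simp: same_cut_Un)
  note D = ext[unfolded extendable_def]
  have zero: "poly p y = 0 \<longleftrightarrow> poly p' y' = 0"
  proof
    assume 0: "poly p y = 0"
    obtain c' where "same_cut \<rho> y c'" "poly p' c' = 0" using matching_root[OF ext 0] .
    then have "(y, c') \<in> root_pairs \<rho> p p'" using 0 by (simp add: root_pairs_def)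
    then show "poly p' y' = 0" using same_cut_pairD(3)[OF rcut] \<open>poly p' c' = 0\<close> by blast
  next
    assume 0: "poly p' y' = 0"
    obtain c where "same_cut (\<rho>\<inverse>) y' c" "poly p c = 0"
      using matching_root[OF extendable_converse[OF ext] 0] .
    then have "(c, y') \<in> root_pairs \<rho> p p'" using 0 by (simp add: root_pairs_def)
    then show "poly p y = 0" using same_cut_pairD(3)[OF rcut] \<open>poly p c = 0\<close> by blast
  qed
  have main: False
    if q: "extendable \<sigma> q q'" "same_cut \<sigma> x x'" "same_cut (root_pairs \<sigma> q q') x x'"
      "x \<notin> Domain \<sigma>" "poly (pderiv q) x > 0" "poly q x > 0" "poly q' x' < 0"
    for \<sigma> :: "('c::real_closed_field \<times> 'd::real_closed_field) set" and q q' x x'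
  proof -
    obtain c' where c': "x' < c'" "same_cut \<sigma> x c'" "poly q' c' = 0"
      using root_right_of[OF q(1,2,4,5)] q(6,7) by (metis less_imp_le)
    obtain c where "same_cut (\<sigma>\<inverse>) c' c" and c0: "poly q c = 0"
      using matching_root[OF extendable_converse[OF q(1)] c'(3)] .
    then have c: "same_cut \<sigma> c c'" by simp
    then have "(c, c') \<in> root_pairs \<sigma> q q'" using c0 c' by (simp add: root_pairs_def)
    then have "x < c" using same_cut_pairD(1)[OF q(3)] c'(1) by blast
    then have "poly q x < poly q c" using monotone_in_cut(1)[OF q(1) c'(2) c q(4)] q(5) by blast
    then show False using c0 q(6) by simp
  qed
  show "same_sign (poly p y) (poly p' y')"
  proof (cases "y \<in> Domain \<rho>")
    case True
    then obtain z' where z': "(y, z') \<in> \<rho>" by blast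
    then have "y' = z'" using same_cut_pairD(3)[OF cut] by blast
    then show ?thesis using z' D by auto
  next
    case False
    have y': "y' \<notin> Domain (\<rho>\<inverse>)" using same_cut_pairD(3)[OF cut] False by auto
    have der: "same_sign (poly (pderiv p) y) (poly (pderiv p') y')" "poly (pderiv p) y \<noteq> 0"
      using D cut derivative_nonzero_in_cut[OF ext cut False] by (auto simp: consistent_def)
    have conv: "same_cut (root_pairs (\<rho>\<inverse>) p' p) y' y" "same_cut (root_pairs \<rho> (- p) (- p')) y y'"
      "same_cut (root_pairs (\<rho>\<inverse>) (- p') (- p)) y' y"
      using rcut by (simp_all add: root_pairs_converse root_pairs_uminus)
    note ext' = extendable_converse[OF ext]
    have 1: "\<not> (poly p y > 0 \<and> poly p' y' < 0)"
    proof
      assume s: "poly p y > 0 \<and> poly p' y' < 0"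
      show False
      proof (cases "poly (pderiv p) y > 0")
        case True
        then show False using main[OF ext cut rcut False] s by blast
      next
        case neg: False
        then have "poly (pderiv (- p')) y' > 0" using der by (auto simp: pderiv_minus same_sign_def order_less_le)
        then show False
          using main[OF extendable_uminus[OF ext'], of y' y] cut conv y' s by simp
      qed
    qed
    have 2: "\<not> (poly p y < 0 \<and> poly p' y' > 0)"
    proof
      assume s: "poly p y < 0 \<and> poly p' y' > 0"
      show False
      proof (cases "poly (pderiv p) y > 0")
        case True
        then have "poly (pderiv p') y' > 0" using der by (auto simp: same_sign_def)
        then show False
          using main[OF ext', of y' y] cut conv y' s by simp
      next
        case neg: False
        then have "poly (pderiv (- p)) y > 0" using der by (auto simp: pderiv_minus order_less_le)
        then show False
          using main[OF extendable_uminus[OF ext] cut conv(2) False] s by simp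
      qed
    qed
    show ?thesis using zero 1 2 unfolding same_sign_def by (metis linorder_neqE less_irrefl)
  qed
qed

section \<open>Transfer of sign conditions in one variable\<close>

text \<open>Coefficients are specialised along ring homomorphisms into two ordered fields. They are bare
  functions between types, so that evaluations at points can be used directly.\<close>

locale unital_ring_hom =
  fixes \<phi> :: "'a::comm_ring_1 \<Rightarrow> 'b::comm_ring_1"
  assumes hom_add: "\<phi> (x + y) = \<phi> x + \<phi> y"
    and hom_mult: "\<phi> (x * y) = \<phi> x * \<phi> y"
    and hom_one: "\<phi> 1 = 1"
begin

lemma hom_zero: "\<phi> 0 = 0"
  using hom_add[of 0 0] by simp

lemma hom_minus: "\<phi> (- x) = - \<phi> x"
  using hom_add[of x "- x"] by (simp add: hom_zero eq_neg_iff_add_eq_0 add.commute)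

lemma hom_diff: "\<phi> (x - y) = \<phi> x - \<phi> y"
  using hom_add[of x "- y"] by (simp add: hom_minus)

lemma hom_power: "\<phi> (x ^ n) = \<phi> x ^ n"
  by (induction n) (simp_all add: hom_one hom_mult)

lemma hom_of_nat: "\<phi> (of_nat n) = of_nat n"
  by (induction n) (simp_all add: hom_zero hom_one hom_add)

lemma hom_sum: "\<phi> (sum f S) = (\<Sum>x\<in>S. \<phi> (f x))"
  by (induction S rule: infinite_finite_induct) (simp_all add: hom_zero hom_add)

lemma map_poly_hom_add: "map_poly \<phi> (p + q) = map_poly \<phi> p + map_poly \<phi> q"
  by (rule poly_eqI) (simp add: coeff_map_poly hom_zero hom_add)

lemma map_poly_hom_diff: "map_poly \<phi> (p - q) = map_poly \<phi> p - map_poly \<phi> q"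
  by (rule poly_eqI) (simp add: coeff_map_poly hom_zero hom_diff)

lemma map_poly_hom_mult: "map_poly \<phi> (p * q) = map_poly \<phi> p * map_poly \<phi> q"
  by (rule poly_eqI) (simp add: coeff_map_poly hom_zero coeff_mult hom_sum hom_mult)

lemma map_poly_hom_smult: "map_poly \<phi> (smult c p) = smult (\<phi> c) (map_poly \<phi> p)"
  by (rule poly_eqI) (simp add: coeff_map_poly hom_zero hom_mult)

lemma map_poly_hom_monom: "map_poly \<phi> (monom c n) = monom (\<phi> c) n"
  by (simp add: map_poly_monom hom_zero)

lemma map_poly_hom_sum: "map_poly \<phi> (sum f S) = (\<Sum>x\<in>S. map_poly \<phi> (f x))"
  by (induction S rule: infinite_finite_induct) (simp_all add: map_poly_hom_add)

end

lemma map_poly_hom_pderiv: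
  fixes \<phi> :: "'a::idom \<Rightarrow> 'b::idom"
  assumes "unital_ring_hom \<phi>"
  shows "map_poly \<phi> (pderiv p) = pderiv (map_poly \<phi> p)"
proof -
  interpret unital_ring_hom \<phi> by fact
  show ?thesis
    by (rule poly_eqI) (simp add: coeff_map_poly coeff_pderiv hom_zero hom_mult hom_of_nat hom_add hom_one)
qed

text \<open>Needed because a specialisation may kill the leading coefficient.\<close>

definition drop_lead :: "'a::comm_ring_1 poly \<Rightarrow> 'a poly" where
  "drop_lead p = p - monom (lead_coeff p) (degree p)"

lemma degree_drop_lead: "degree p > 0 \<Longrightarrow> degree (drop_lead p) < degree p"
proof -
  assume "degree p > 0"
  have "degree (drop_lead p) \<le> degree p - 1"
    by (rule degree_le) (auto simp: drop_lead_def coeff_eq_0)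
  with \<open>degree p > 0\<close> show ?thesis by linarith
qed

text \<open>The auxiliary polynomials whose signs determine the sign diagram of \<open>F\<close>: derivatives give
  monotonicity, pseudo-remainders give the signs at roots of other polynomials, and truncations
  account for leading coefficients that vanish after specialisation. Every rule lowers the degree
  strictly below that of all its premises, which is why the closure of a finite set is finite.\<close>

inductive_set sign_closure :: "'a::{idom,ring_char_0} poly set \<Rightarrow> 'a poly set" for F where
  base: "P \<in> F \<Longrightarrow> P \<in> sign_closure F"
| deriv: "P \<in> sign_closure F \<Longrightarrow> degree P > 0 \<Longrightarrow> pderiv P \<in> sign_closure F"
| drop: "P \<in> sign_closure F \<Longrightarrow> degree P > 0 \<Longrightarrow> drop_lead P \<in> sign_closure F"
| rem: "P \<in> sign_closure F \<Longrightarrow> Q \<in> sign_closure F \<Longrightarrow> degree Q > 0 \<Longrightarrow> degree Q \<le> degree P \<Longrightarrow>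
    pseudo_mod P Q \<in> sign_closure F"

lemma degree_pseudo_mod_less:
  fixes P Q :: "'a::idom poly"
  assumes "degree Q > 0"
  shows "degree (pseudo_mod P Q) < degree Q"
  using pseudo_mod(2)[of Q P] assms by (cases "Q = 0") auto

text \<open>By downward induction on the degree: elements of a given degree arise from finitely many elements
  of larger degree.\<close>

lemma finite_sign_closure:
  assumes "finite F"
  shows "finite (sign_closure F)"
proof -
  obtain N where N: "\<And>P. P \<in> F \<Longrightarrow> degree P \<le> N"
    using finite_nat_set_iff_bounded_le[of "degree ` F"] assms by auto
  have bound: "degree P \<le> N" if "P \<in> sign_closure F" for P
    using that
  proof induction
    case (deriv P)
    then show ?case by (simp add: degree_pderiv)
  next
    case (drop P)
    then show ?case using degree_drop_lead[of P] by simp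
  next
    case (rem P Q)
    then show ?case using degree_pseudo_mod_less[of Q P] by simp
  qed (rule N)
  \<comment> \<open>S j collects the j largest degrees; its generating pairs lie in the preceding level.\<close>
  define S where "S j = {P \<in> sign_closure F. N < degree P + j}" for j
  have "finite (S j)" for j
  proof (induction j)
    case 0
    have "S 0 = {}" using bound by (fastforce simp: S_def)
    then show ?case by simp
  next
    case (Suc j)
    have "S (Suc j) \<subseteq> F \<union> pderiv ` S j \<union> drop_lead ` S j \<union> (\<lambda>(P, Q). pseudo_mod P Q) ` (S j \<times> S j)"
    proof
      fix R assume "R \<in> S (Suc j)"
      then have R: "R \<in> sign_closure F" "N \<le> degree R + j" by (auto simp: S_def)
      from R(1) show "R \<in> F \<union> pderiv ` S j \<union> drop_lead ` S j \<union> (\<lambda>(P, Q). pseudo_mod P Q) ` (S j \<times> S j)"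
      proof cases
        case base
        then show ?thesis by simp
      next
        case (deriv P)
        then have "degree R < degree P" by (simp add: degree_pderiv)
        then show ?thesis using deriv R(2) by (auto simp: S_def)
      next
        case (drop P)
        then have "degree R < degree P" using degree_drop_lead by simp
        then show ?thesis using drop R(2) by (auto simp: S_def)
      next
        case (rem P Q)
        then have "degree R < degree Q" using degree_pseudo_mod_less by blast
        then have "(P, Q) \<in> S j \<times> S j" using rem R(2) by (auto simp: S_def)
        then show ?thesis using rem(1) by force
      qed
    qed
    then show ?case using Suc assms by (auto intro: finite_subset)
  qed
  moreover have "sign_closure F = S (Suc N)" by (auto simp: S_def)
  ultimately show ?thesis by simp
qed

locale sign_equal_homs =
  \<phi>: unital_ring_hom \<phi> + \<psi>: unital_ring_hom \<psi>
  for \<phi> :: "'r::{idom,ring_char_0} \<Rightarrow> 'a::real_closed_field"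
    and \<psi> :: "'r \<Rightarrow> 'b::real_closed_field" +
  fixes F :: "'r poly set"
  assumes finite_F: "finite F"
    and same_coeff_signs: "P \<in> sign_closure F \<Longrightarrow> same_sign (\<phi> (coeff P i)) (\<psi> (coeff P i))"
begin

text \<open>The degree survives both specialisations, because leading coefficients have the same sign under both.\<close>

definition nondegenerate :: "'r poly \<Rightarrow> bool" where
  "nondegenerate P \<longleftrightarrow> P \<in> sign_closure F \<and> \<phi> (lead_coeff P) \<noteq> 0"

lemma nondegenerate_closure: "nondegenerate P \<Longrightarrow> P \<in> sign_closure F"
  by (simp add: nondegenerate_def)

lemma nondegenerate_degree:
  assumes "nondegenerate P"
  shows "degree (map_poly \<phi> P) = degree P" "degree (map_poly \<psi> P) = degree P"
    "lead_coeff (map_poly \<phi> P) = \<phi> (lead_coeff P)" "lead_coeff (map_poly \<psi> P) = \<psi> (lead_coeff P)"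
proof -
  have "\<phi> (lead_coeff P) \<noteq> 0" "\<psi> (lead_coeff P) \<noteq> 0"
    using assms same_sign_zero[OF same_coeff_signs] by (auto simp: nondegenerate_def)
  then show deg: "degree (map_poly \<phi> P) = degree P" "degree (map_poly \<psi> P) = degree P"
    by (simp_all add: map_poly_degree_eq)
  show "lead_coeff (map_poly \<phi> P) = \<phi> (lead_coeff P)" "lead_coeff (map_poly \<psi> P) = \<psi> (lead_coeff P)"
    unfolding deg by (simp_all add: coeff_map_poly \<phi>.hom_zero \<psi>.hom_zero)
qed

text \<open>Dropping leading terms that specialise to zero reaches a polynomial whose degree survives.\<close>

lemma nondegenerate_representative:
  assumes "P \<in> sign_closure F"
  shows "(map_poly \<phi> P = 0 \<and> map_poly \<psi> P = 0) \<or>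
    (\<exists>R. nondegenerate R \<and> degree R \<le> degree P \<and> map_poly \<phi> R = map_poly \<phi> P \<and> map_poly \<psi> R = map_poly \<psi> P)"
  using assms
proof (induction "degree P" arbitrary: P rule: less_induct)
  case less
  show ?case
  proof (cases "nondegenerate P")
    case False
    then have 0: "\<phi> (lead_coeff P) = 0" "\<psi> (lead_coeff P) = 0"
      using less.prems same_sign_zero[OF same_coeff_signs[OF less.prems]] by (auto simp: nondegenerate_def)
    show ?thesis
    proof (cases "degree P = 0")
      case True
      then obtain c where "P = [:c:]" by (metis degree_eq_zeroE)
      then show ?thesis using 0 by (simp add: map_poly_pCons \<phi>.hom_zero \<psi>.hom_zero)
    next
      case pos: False
      then have lt: "degree (drop_lead P) < degree P" and mem: "drop_lead P \<in> sign_closure F"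
        using degree_drop_lead[of P] less.prems by (simp_all add: sign_closure.drop)
      have "map_poly \<phi> (drop_lead P) = map_poly \<phi> P" "map_poly \<psi> (drop_lead P) = map_poly \<psi> P"
        unfolding drop_lead_def
        by (simp_all add: \<phi>.map_poly_hom_diff \<psi>.map_poly_hom_diff \<phi>.map_poly_hom_monom
            \<psi>.map_poly_hom_monom 0)
      then show ?thesis using less.hyps[OF lt mem] lt by force
    qed
  qed blast
qed

text \<open>The listed points must be roots of members of \<open>S\<close> of positive degree. At such a root the sign of a new polynomial
  is read off from a pseudo-remainder.\<close>

definition diagram :: "('a \<times> 'b) set \<Rightarrow> 'r poly set \<Rightarrow> bool" where
  "diagram \<rho> S \<longleftrightarrow> finite \<rho> \<and> increasing_pairs \<rho> \<and>
     (\<forall>P\<in>S. consistent \<rho> (map_poly \<phi> P) (map_poly \<psi> P)) \<and>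
     (\<forall>(z, z')\<in>\<rho>. \<exists>Q\<in>S. degree Q > 0 \<and> poly (map_poly \<phi> Q) z = 0 \<and> poly (map_poly \<psi> Q) z' = 0)"

text \<open>At a common root of \<open>Q\<close> the identity \<open>c^k P = Q q + R\<close> leaves \<open>c^k P = R\<close>, and \<open>R\<close> has
  smaller degree, so its sign is already controlled by the diagram.\<close>

lemma same_sign_at_points:
  assumes diag: "diagram \<rho> S" and S: "{P. nondegenerate P \<and> degree P < n} \<subseteq> S" "\<And>Q. Q \<in> S \<Longrightarrow> nondegenerate Q \<and> degree Q \<le> n"
    and P: "nondegenerate P" "degree P = n" and z: "(z, z') \<in> \<rho>"
  shows "same_sign (poly (map_poly \<phi> P) z) (poly (map_poly \<psi> P) z')"
proof -
  obtain Q where Q: "Q \<in> S" "degree Q > 0" "poly (map_poly \<phi> Q) z = 0" "poly (map_poly \<psi> Q) z' = 0"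
    using diag z by (fastforce simp: diagram_def)
  have gQ: "nondegenerate Q" "degree Q \<le> n" using S(2) Q(1) by auto
  define R where "R = pseudo_mod P Q"
  have R: "R \<in> sign_closure F" "degree R < n"
    using sign_closure.rem[of P F Q] degree_pseudo_mod_less[OF Q(2), of P] Q gQ P
    by (auto simp: R_def nondegenerate_def)
  have cut: "same_cut \<rho> z z'" using diag z by (simp add: diagram_def increasing_pairsD)
  have sR: "same_sign (poly (map_poly \<phi> R) z) (poly (map_poly \<psi> R) z')"
    using nondegenerate_representative[OF R(1)]
  proof (elim disjE exE conjE)
    fix R' assume R': "nondegenerate R'" "degree R' \<le> degree R" "map_poly \<phi> R' = map_poly \<phi> R" "map_poly \<psi> R' = map_poly \<psi> R"
    then have "R' \<in> S" using S(1) R(2) by auto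
    then have "consistent \<rho> (map_poly \<phi> R') (map_poly \<psi> R')" using diag by (simp add: diagram_def)
    then show ?thesis using consistentD[OF _ cut] R' by metis
  qed simp
  define c k where "c = lead_coeff Q" and "k = Suc (degree P) - degree Q"
  obtain q r where qr: "pseudo_divmod P Q = (q, r)" by fastforce
  have "Q \<noteq> 0" using Q(2) by auto
  then have eq: "smult (c ^ k) P = Q * q + R"
    using pseudo_divmod(1)[OF _ qr] qr by (simp add: c_def k_def R_def pseudo_mod_def)
  have "\<phi> c ^ k * poly (map_poly \<phi> P) z = poly (map_poly \<phi> R) z"
    using arg_cong[OF eq, of "\<lambda>p. poly (map_poly \<phi> p) z"] Q
    by (simp add: \<phi>.map_poly_hom_smult \<phi>.map_poly_hom_add \<phi>.map_poly_hom_mult \<phi>.hom_power)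
  moreover have "\<psi> c ^ k * poly (map_poly \<psi> P) z' = poly (map_poly \<psi> R) z'"
    using arg_cong[OF eq, of "\<lambda>p. poly (map_poly \<psi> p) z'"] Q
    by (simp add: \<psi>.map_poly_hom_smult \<psi>.map_poly_hom_add \<psi>.map_poly_hom_mult \<psi>.hom_power)
  moreover have "same_sign (\<phi> c ^ k) (\<psi> c ^ k)" "\<phi> c ^ k \<noteq> 0"
    using gQ same_coeff_signs[of Q] by (auto simp: c_def nondegenerate_def intro: same_sign_power)
  ultimately show ?thesis using sR same_sign_mult_cancel by metis
qed

lemma diagram_insert:
  assumes diag: "diagram \<rho> S" and S: "{P. nondegenerate P \<and> degree P < n} \<subseteq> S" "\<And>Q. Q \<in> S \<Longrightarrow> nondegenerate Q \<and> degree Q \<le> n"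
    and P: "nondegenerate P" "degree P = n"
  shows "\<exists>\<rho>'. diagram \<rho>' (insert P S)"
proof (cases "n = 0")
  case True
  then obtain c where c: "P = [:c:]" using P by (metis degree_eq_zeroE)
  have "same_sign (\<phi> c) (\<psi> c)"
    using same_coeff_signs[OF nondegenerate_closure[OF P(1)], of 0] by (simp add: c)
  then have "consistent \<rho> (map_poly \<phi> P) (map_poly \<psi> P)"
    by (simp add: consistent_def c map_poly_pCons \<phi>.hom_zero \<psi>.hom_zero)
  then have "diagram \<rho> (insert P S)" using diag by (auto simp: diagram_def)
  then show ?thesis ..
next
  case False
  let ?p = "map_poly \<phi> P" and ?p' = "map_poly \<psi> P"
  have "lead_coeff (pderiv P) = of_nat n * lead_coeff P"
    using P False by (simp add: degree_pderiv coeff_pderiv)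
  then have "nondegenerate (pderiv P)"
    using P False \<phi>.hom_mult \<phi>.hom_of_nat sign_closure.deriv[of P F] by (simp add: nondegenerate_def)
  then have "pderiv P \<in> S" using S(1) P False by (auto simp: degree_pderiv)
  then have "consistent \<rho> (pderiv ?p) (pderiv ?p')"
    using diag by (auto simp: diagram_def simp flip: map_poly_hom_pderiv[OF \<phi>.unital_ring_hom_axioms] map_poly_hom_pderiv[OF \<psi>.unital_ring_hom_axioms])
  moreover have "same_sign (lead_coeff ?p) (lead_coeff ?p')"
    using nondegenerate_degree(3,4)[OF P(1)] same_coeff_signs[OF nondegenerate_closure[OF P(1)], of "degree P"] by simp
  moreover have "same_sign (poly ?p z) (poly ?p' z')" if "(z, z') \<in> \<rho>" for z z'
    using same_sign_at_points[OF diag S P that] .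
  moreover have "degree ?p = degree ?p'" "degree ?p > 0"
    using nondegenerate_degree(1,2)[OF P(1)] P False by simp_all
  ultimately have ext: "extendable \<rho> ?p ?p'"
    using diag unfolding extendable_def diagram_def by blast
  let ?\<rho> = "\<rho> \<union> root_pairs \<rho> ?p ?p'"
  have "?p \<noteq> 0" "?p' \<noteq> 0" using extendableD(6,7)[OF ext] by auto
  then have "finite ?\<rho>" using finite_root_pairs diag by (simp add: diagram_def)
  moreover have "increasing_pairs ?\<rho>" by (rule increasing_Un_root_pairs[OF ext])
  moreover have "consistent ?\<rho> ?p ?p'" by (rule consistent_Un_root_pairs[OF ext])
  moreover have "consistent ?\<rho> (map_poly \<phi> Q) (map_poly \<psi> Q)" if "Q \<in> S" for Q
    using diag that by (auto simp: diagram_def consistent_def same_cut_Un)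
  moreover have "\<exists>Q\<in>insert P S. degree Q > 0 \<and> poly (map_poly \<phi> Q) z = 0 \<and> poly (map_poly \<psi> Q) z' = 0"
    if "(z, z') \<in> ?\<rho>" for z z'
  proof (cases "(z, z') \<in> \<rho>")
    case True
    then show ?thesis using diag by (fastforce simp: diagram_def)
  next
    case F: False
    then show ?thesis using that P False by (auto simp: root_pairs_def)
  qed
  ultimately have "diagram ?\<rho> (insert P S)" unfolding diagram_def by blast
  then show ?thesis ..
qed

text \<open>Diagrams are built degree by degree, and within one degree one polynomial at a time.\<close>

lemma diagram_exists: "\<exists>\<rho>. diagram \<rho> {P. nondegenerate P \<and> degree P < n}"
proof (induction n)
  case 0
  have "diagram {} {P. nondegenerate P \<and> degree P < 0}"
    by (simp add: diagram_def increasing_pairs_def)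
  then show ?case ..
next
  case (Suc n)
  define L where "L = {P. nondegenerate P \<and> degree P < n}"
  have step: "\<exists>\<rho>. diagram \<rho> (L \<union> T)" if "finite T" "T \<subseteq> {P. nondegenerate P \<and> degree P = n}" for T
    using that
  proof (induction T)
    case empty
    then show ?case using Suc by (simp add: L_def)
  next
    case (insert P T)
    then obtain \<rho> where "diagram \<rho> (L \<union> T)" by auto
    then have "\<exists>\<rho>'. diagram \<rho>' (insert P (L \<union> T))"
      by (rule diagram_insert[where n = n]) (use insert.prems in \<open>auto simp: L_def\<close>)
    then show ?case by simp
  qed
  have fin: "finite {P. nondegenerate P \<and> degree P = n}"
    using finite_sign_closure[OF finite_F] by (rule rev_finite_subset) (auto simp: nondegenerate_def)
  have eq: "L \<union> {P. nondegenerate P \<and> degree P = n} = {P. nondegenerate P \<and> degree P < Suc n}"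
    by (auto simp: L_def)
  show ?case using step[OF fin order_refl] by (simp only: eq)
qed

lemma sign_equal_point: "\<exists>y'. \<forall>P\<in>F. same_sign (poly (map_poly \<phi> P) y) (poly (map_poly \<psi> P) y')"
proof -
  obtain N where N: "\<And>P. P \<in> F \<Longrightarrow> degree P < N"
    using finite_nat_set_iff_bounded[of "degree ` F"] finite_F by auto
  obtain \<rho> where diag: "diagram \<rho> {P. nondegenerate P \<and> degree P < N}" using diagram_exists by blast
  then obtain y' where cut: "same_cut \<rho> y y'"
    using same_cut_exists[of \<rho> y] by (auto simp: diagram_def)
  have "same_sign (poly (map_poly \<phi> P) y) (poly (map_poly \<psi> P) y')" if "P \<in> F" for P
    using nondegenerate_representative[OF sign_closure.base[OF that]]
  proof (elim disjE exE conjE)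
    fix R assume R: "nondegenerate R" "degree R \<le> degree P" "map_poly \<phi> R = map_poly \<phi> P" "map_poly \<psi> R = map_poly \<psi> P"
    then have "consistent \<rho> (map_poly \<phi> R) (map_poly \<psi> R)"
      using diag N[OF that] by (auto simp: diagram_def)
    then show ?thesis using consistentD[OF _ cut] R by metis
  qed simp
  then show ?thesis by blast
qed

end

text \<open>Quantifier elimination for one variable in back-and-forth form. For finitely many polynomials
  with parameters, finitely many sign conditions on the parameters decide which sign vectors
  are realised by the variable, for any two real closed fields; so a point over one specialisation
  has a counterpart over every other one with the same parameter signs.\<close>

theorem one_variable_transfer:
  fixes F :: "'r::{idom,ring_char_0} poly set"
  assumes "finite F"
  obtains G where "finite G"
    "\<And>(\<phi> :: 'r \<Rightarrow> 'a::real_closed_field) (\<psi> :: 'r \<Rightarrow> 'b::real_closed_field) y.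
      unital_ring_hom \<phi> \<Longrightarrow> unital_ring_hom \<psi> \<Longrightarrow> (\<And>g. g \<in> G \<Longrightarrow> same_sign (\<phi> g) (\<psi> g)) \<Longrightarrow>
      \<exists>y'. \<forall>P\<in>F. same_sign (poly (map_poly \<phi> P) y) (poly (map_poly \<psi> P) y')"
proof
  \<comment> \<open>The coefficient list stops at the degree, so the coefficient 0 beyond it is added by hand.\<close>
  let ?G = "insert 0 (\<Union>P\<in>sign_closure F. set (coeffs P))"
  show "finite ?G" using finite_sign_closure[OF assms] by simp
  fix \<phi> :: "'r \<Rightarrow> 'a" and \<psi> :: "'r \<Rightarrow> 'b" and y
  assume hom: "unital_ring_hom \<phi>" "unital_ring_hom \<psi>" and sgn: "\<And>g. g \<in> ?G \<Longrightarrow> same_sign (\<phi> g) (\<psi> g)"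
  interpret sign_equal_homs \<phi> \<psi> F
  proof (intro sign_equal_homs.intro sign_equal_homs_axioms.intro hom assms)
    fix P i assume "P \<in> sign_closure F"
    moreover have "coeff P i \<in> insert 0 (set (coeffs P))"
      by (metis coeff_in_coeffs coeff_eq_0 degree_0 insertCI le_degree coeff_0)
    ultimately show "same_sign (\<phi> (coeff P i)) (\<psi> (coeff P i))" by (intro sgn) blast
  qed
  show "\<exists>y'. \<forall>P\<in>F. same_sign (poly (map_poly \<phi> P) y) (poly (map_poly \<psi> P) y')"
    by (rule sign_equal_point)
qed

section \<open>Transfer of sign conditions to the reals\<close>

text \<open>The value of the monomial with exponents \<open>m\<close> at the point \<open>a\<close>, for possibly infinitely many
  variables.\<close>

definition power_product :: "('n \<Rightarrow> 'r::comm_ring_1) \<Rightarrow> ('n \<Rightarrow>\<^sub>0 nat) \<Rightarrow> 'r" where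
  "power_product a m = (\<Prod>i\<in>Poly_Mapping.keys m. a i ^ Poly_Mapping.lookup m i)"

lemma power_product_superset:
  assumes "finite S" "Poly_Mapping.keys m \<subseteq> S"
  shows "power_product a m = (\<Prod>i\<in>S. a i ^ Poly_Mapping.lookup m i)"
  unfolding power_product_def
  by (rule prod.mono_neutral_left) (use assms in \<open>auto simp: in_keys_iff\<close>)

lemma power_product_0 [simp]: "power_product a 0 = 1"
  by (simp add: power_product_def)

lemma power_product_add: "power_product a (m + l) = power_product a m * power_product a l"
proof -
  let ?S = "Poly_Mapping.keys m \<union> Poly_Mapping.keys l"
  have "Poly_Mapping.keys (m + l) \<subseteq> ?S" by (rule Poly_Mapping.keys_add)
  then show ?thesis
    by (simp add: power_product_superset[where S = ?S] lookup_add power_add prod.distrib)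
qed

text \<open>Evaluation with coefficients mapped by \<open>h\<close> and monomials mapped by \<open>\<mu>\<close>. A general \<open>h\<close> is
  needed to evaluate real polynomials in fields containing a copy of the reals.\<close>

definition monoid_eval :: "(real \<Rightarrow> 'r::comm_ring_1) \<Rightarrow> (('n \<Rightarrow>\<^sub>0 nat) \<Rightarrow> 'r) \<Rightarrow> 'n mpoly \<Rightarrow> 'r" where
  "monoid_eval h \<mu> p = (\<Sum>m\<in>Poly_Mapping.keys p. h (Poly_Mapping.lookup p m) * \<mu> m)"

context
  fixes h :: "real \<Rightarrow> 'r::comm_ring_1"
  assumes hom: "unital_ring_hom h"
begin

interpretation h: unital_ring_hom h by (rule hom)

lemma monoid_eval_superset:
  assumes "finite S" "Poly_Mapping.keys p \<subseteq> S"
  shows "monoid_eval h \<mu> p = (\<Sum>m\<in>S. h (Poly_Mapping.lookup p m) * \<mu> m)"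
  unfolding monoid_eval_def
  by (rule sum.mono_neutral_left) (use assms in \<open>auto simp: in_keys_iff h.hom_zero\<close>)

lemma monoid_eval_single: "monoid_eval h \<mu> (Poly_Mapping.single m c) = h c * \<mu> m"
  by (subst monoid_eval_superset[where S = "{m}"]) auto

lemma monoid_eval_add: "monoid_eval h \<mu> (p + q) = monoid_eval h \<mu> p + monoid_eval h \<mu> q"
proof -
  let ?S = "Poly_Mapping.keys p \<union> Poly_Mapping.keys q"
  have "Poly_Mapping.keys (p + q) \<subseteq> ?S" by (rule Poly_Mapping.keys_add)
  then show ?thesis
    by (simp add: monoid_eval_superset[where S = ?S] lookup_add h.hom_add sum.distrib algebra_simps)
qed

lemma monoid_eval_hom:
  assumes "\<mu> 0 = 1" "\<And>m l. \<mu> (m + l) = \<mu> m * \<mu> l"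
  shows "unital_ring_hom (monoid_eval h \<mu>)"
proof
  show "monoid_eval h \<mu> 1 = 1"
    by (simp add: monoid_eval_single h.hom_one assms flip: single_one)
  show "monoid_eval h \<mu> (p * q) = monoid_eval h \<mu> p * monoid_eval h \<mu> q" for p q
  proof (induction p rule: mpoly_induct)
    case (single m c)
    show ?case
      by (induction q rule: mpoly_induct)
        (auto simp: mult_single monoid_eval_single monoid_eval_add assms h.hom_mult algebra_simps)
  next
    case (add p1 p2)
    then show ?case by (simp add: monoid_eval_add algebra_simps)
  qed
qed (rule monoid_eval_add)

lemma power_product_eval_hom: "unital_ring_hom (monoid_eval h (power_product a))"
  by (rule monoid_eval_hom) (simp_all add: power_product_add)

end

text \<open>Instead of removing the variable \<open>v\<close> from the coefficients, the whole monomial is kept there.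
  Evaluated at a point whose \<open>v\<close>-th coordinate is \<open>1\<close>, this makes no difference, and no notion of
  a polynomial without \<open>v\<close> is required.\<close>

definition in_variable :: "nat \<Rightarrow> nat mpoly \<Rightarrow> nat mpoly poly" where
  "in_variable v f = (\<Sum>m\<in>Poly_Mapping.keys f. monom (Poly_Mapping.single m (Poly_Mapping.lookup f m)) (Poly_Mapping.lookup m v))"

lemma power_product_upd:
  "power_product (a(v := y)) m = power_product (a(v := 1)) m * y ^ Poly_Mapping.lookup m v"
proof -
  let ?S = "insert v (Poly_Mapping.keys m)"
  have S: "finite ?S" "Poly_Mapping.keys m \<subseteq> ?S" by auto
  have "(\<Prod>i\<in>?S - {v}. (a(v := y)) i ^ Poly_Mapping.lookup m i) = (\<Prod>i\<in>?S - {v}. (a(v := 1)) i ^ Poly_Mapping.lookup m i)"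
    by (rule prod.cong) auto
  then show ?thesis
    unfolding power_product_superset[OF S] prod.remove[OF S(1) insertI1] by simp
qed

lemma eval_in_variable:
  fixes h :: "real \<Rightarrow> 'r::comm_ring_1"
  assumes hom: "unital_ring_hom h" and a: "a v = 1"
  shows "poly (map_poly (monoid_eval h (power_product a)) (in_variable v f)) y =
    monoid_eval h (power_product (a(v := y))) f"
proof -
  interpret e: unital_ring_hom "monoid_eval h (power_product a)"
    by (rule power_product_eval_hom[OF hom])
  have "a(v := 1) = a" using a by auto
  then have "power_product (a(v := y)) m = power_product a m * y ^ Poly_Mapping.lookup m v" for m
    using power_product_upd[of a v y m] by simp
  then show ?thesis
    by (simp add: in_variable_def e.map_poly_hom_sum e.map_poly_hom_monom poly_sum poly_monom
        monoid_eval_single[OF hom] monoid_eval_def[of h "power_product (a(v := y))"] mult.assoc)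
qed

text \<open>Positive reals are squares of units, hence their images are positive.\<close>

lemma real_hom_same_sign:
  fixes h :: "real \<Rightarrow> 'a::linordered_field"
  assumes "unital_ring_hom h"
  shows "same_sign (h c) c"
proof -
  interpret unital_ring_hom h by fact
  have pos: "h c > 0" if "c > 0" for c
  proof -
    have "h c = h (sqrt c) ^ 2" using that by (simp flip: hom_power)
    moreover have "h c * h (1 / c) = 1" using that by (simp add: hom_one flip: hom_mult)
    ultimately show ?thesis by (metis mult_zero_left zero_le_power2 order_le_less zero_neq_one)
  qed
  show ?thesis
    using pos[of c] pos[of "- c"] hom_zero hom_minus[of c]
    by (cases c "0 :: real" rule: linorder_cases) (auto simp: same_sign_def)
qed

text \<open>Variables are handled one at a time: those outside \<open>V\<close> have the value \<open>1\<close>, so the induction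
  on \<open>V\<close> starts with polynomials that are evaluated to real constants.\<close>

lemma transfer_to_real:
  fixes h :: "real \<Rightarrow> 'a::real_closed_field" and a :: "nat \<Rightarrow> 'a"
  assumes hom: "unital_ring_hom h" and "finite V" and "finite F" "\<And>i. i \<notin> V \<Longrightarrow> a i = 1"
  shows "\<exists>b. (\<forall>i. i \<notin> V \<longrightarrow> b i = 1) \<and>
    (\<forall>f\<in>F. same_sign (monoid_eval h (power_product a) f) (monoid_eval (\<lambda>c. c) (power_product b) f))"
  using assms(2-)
proof (induction V arbitrary: a F)
  case empty
  interpret h: unital_ring_hom h by (rule hom)
  have "a = (\<lambda>_. 1)" using empty by auto
  then have "monoid_eval h (power_product a) f = h (monoid_eval (\<lambda>c. c) (power_product (\<lambda>_. 1)) f)" for f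
    by (simp add: monoid_eval_def power_product_def h.hom_sum)
  then show ?case using real_hom_same_sign[OF hom] by (intro exI[of _ "\<lambda>_. 1"]) simp
next
  case (insert v V)
  have id: "unital_ring_hom (\<lambda>c :: real. c)" by standard auto
  obtain G where G: "finite G"
    "\<And>(\<phi> :: nat mpoly \<Rightarrow> 'a) (\<psi> :: nat mpoly \<Rightarrow> real) y.
      unital_ring_hom \<phi> \<Longrightarrow> unital_ring_hom \<psi> \<Longrightarrow> (\<And>g. g \<in> G \<Longrightarrow> same_sign (\<phi> g) (\<psi> g)) \<Longrightarrow>
      \<exists>y'. \<forall>P\<in>in_variable v ` F. same_sign (poly (map_poly \<phi> P) y) (poly (map_poly \<psi> P) y')"
    using one_variable_transfer[of "in_variable v ` F"] insert.prems(1) by blast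
  \<comment> \<open>The parameters are the remaining coordinates; the coordinate v re-enters as the value of the new variable.\<close>
  define a1 where "a1 = a(v := 1)"
  have "a1 i = 1" if "i \<notin> V" for i using insert.prems(2) that by (auto simp: a1_def)
  from insert.IH[of G a1, OF G(1) this] obtain b1 where b1: "\<And>i. i \<notin> V \<Longrightarrow> b1 i = 1"
    "\<And>g. g \<in> G \<Longrightarrow> same_sign (monoid_eval h (power_product a1) g) (monoid_eval (\<lambda>c. c) (power_product b1) g)"
    by blast
  from G(2)[OF power_product_eval_hom[OF hom] power_product_eval_hom[OF id] b1(2), of "a v"]
  obtain y' where y': "\<And>f. f \<in> F \<Longrightarrow>
      same_sign (poly (map_poly (monoid_eval h (power_product a1)) (in_variable v f)) (a v))
        (poly (map_poly (monoid_eval (\<lambda>c. c) (power_product b1)) (in_variable v f)) y')"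
    by blast
  have "a1(v := a v) = a" "a1 v = 1" by (auto simp: a1_def)
  moreover have "b1 v = 1" using b1(1) insert.hyps by simp
  ultimately have "\<forall>f\<in>F. same_sign (monoid_eval h (power_product a) f)
      (monoid_eval (\<lambda>c. c) (power_product (b1(v := y'))) f)"
    using y' by (simp add: eval_in_variable[OF hom] eval_in_variable[OF id])
  moreover have "\<forall>i. i \<notin> insert v V \<longrightarrow> (b1(v := y')) i = 1" using b1(1) by auto
  ultimately show ?case by blast
qed

section \<open>Maximal positive cones\<close>

text \<open>The nonnegative elements of a partial order on the subfield \<open>diff_field P\<close> of an ambient field in
  which all squares of that subfield are nonnegative. The subfield is recovered from the cone, so
  inclusion of cones extends the field and the order at the same time.\<close>

definition field_cone :: "'c::field set \<Rightarrow> bool" where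
  "field_cone P \<longleftrightarrow> 1 \<in> P \<and> - 1 \<notin> P \<and> (\<forall>x\<in>P. inverse x \<in> P) \<and>
     (\<forall>x\<in>P. \<forall>y\<in>P. x + y \<in> P \<and> x * y \<in> P \<and> (x - y)\<^sup>2 \<in> P)"

definition max_cone :: "'c::field set \<Rightarrow> bool" where
  "max_cone P \<longleftrightarrow> field_cone P \<and> (\<forall>Q. field_cone Q \<longrightarrow> P \<subseteq> Q \<longrightarrow> Q = P)"

definition diff_field :: "'c::field set \<Rightarrow> 'c set" where
  "diff_field P = {x - y | x y. x \<in> P \<and> y \<in> P}"

lemma field_coneD:
  assumes "field_cone P"
  shows "1 \<in> P" "0 \<in> P" "- 1 \<notin> P" "x \<in> P \<Longrightarrow> inverse x \<in> P"
    "x \<in> P \<Longrightarrow> y \<in> P \<Longrightarrow> x + y \<in> P" "x \<in> P \<Longrightarrow> y \<in> P \<Longrightarrow> x * y \<in> P"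
    "x \<in> P \<Longrightarrow> y \<in> P \<Longrightarrow> (x - y)\<^sup>2 \<in> P"
proof -
  show "0 \<in> P" using assms unfolding field_cone_def
    by (metis diff_self zero_power2)
qed (use assms in \<open>auto simp: field_cone_def\<close>)

lemma max_cone_exists:
  assumes "field_cone P"
  obtains Q where "max_cone Q" "P \<subseteq> Q"
proof -
  define A where "A = {Q. field_cone Q \<and> P \<subseteq> Q}"
  have "\<exists>M\<in>A. \<forall>Q\<in>A. M \<subseteq> Q \<longrightarrow> Q = M"
  proof (rule subset_Zorn_nonempty)
    show "A \<noteq> {}" using assms by (auto simp: A_def)
    fix \<C> assume ne: "\<C> \<noteq> {}" and ch: "subset.chain A \<C>"
    then have cone: "field_cone Q" "P \<subseteq> Q" if "Q \<in> \<C>" for Q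
      using that by (auto simp: subset.chain_def A_def)
    have two: "\<exists>Q\<in>\<C>. x \<in> Q \<and> y \<in> Q" if "x \<in> \<Union>\<C>" "y \<in> \<Union>\<C>" for x y
    proof -
      obtain Q R where QR: "Q \<in> \<C>" "x \<in> Q" "R \<in> \<C>" "y \<in> R" using \<open>x \<in> _\<close> \<open>y \<in> _\<close> by blast
      then have "Q \<subseteq> R \<or> R \<subseteq> Q" using ch unfolding subset_chain_def by blast
      then show ?thesis using QR by blast
    qed
    have "field_cone (\<Union>\<C>)"
      unfolding field_cone_def
    proof (intro conjI ballI)
      show "1 \<in> \<Union>\<C>" using ne field_coneD(1)[OF cone(1)] by blast
      show "- 1 \<notin> \<Union>\<C>" using field_coneD(3)[OF cone(1)] by blast
      show "inverse x \<in> \<Union>\<C>" if "x \<in> \<Union>\<C>" for x using that field_coneD(4)[OF cone(1)] by blast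
      fix x y assume "x \<in> \<Union>\<C>" "y \<in> \<Union>\<C>"
      then obtain Q where "Q \<in> \<C>" "x \<in> Q" "y \<in> Q" using two by blast
      then have "x + y \<in> Q" "x * y \<in> Q" "(x - y)\<^sup>2 \<in> Q"
        using field_coneD(5-7)[OF cone(1)] by simp_all
      then show "x + y \<in> \<Union>\<C>" "x * y \<in> \<Union>\<C>" "(x - y)\<^sup>2 \<in> \<Union>\<C>"
        using \<open>Q \<in> \<C>\<close> by blast+
    qed
    moreover obtain Q where "Q \<in> \<C>" using ne by blast
    ultimately show "\<Union>\<C> \<in> A" using cone(2) by (auto simp: A_def)
  qed
  then obtain M where "M \<in> A" and max: "\<And>Q. Q \<in> A \<Longrightarrow> M \<subseteq> Q \<Longrightarrow> Q = M" by auto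
  then have M: "field_cone M" "P \<subseteq> M" by (simp_all add: A_def)
  have "Q = M" if "field_cone Q" "M \<subseteq> Q" for Q
    using max[of Q] that M(2) by (simp add: A_def)
  then have "max_cone M" using M(1) by (simp add: max_cone_def)
  then show ?thesis using M(2) by (rule that)
qed

lemma cone_pointed:
  assumes "field_cone P" "x \<in> P" "- x \<in> P"
  shows "x = 0"
proof (rule ccontr)
  assume "x \<noteq> 0"
  then have "- x * inverse x = - 1" by simp
  then show False using field_coneD(3,4,6)[OF assms(1)] assms(2,3) by metis
qed

lemma diff_field_closed:
  assumes P: "field_cone P"
  shows "x \<in> P \<Longrightarrow> x \<in> diff_field P" "0 \<in> diff_field P" "1 \<in> diff_field P"
    "x \<in> diff_field P \<Longrightarrow> y \<in> diff_field P \<Longrightarrow> x + y \<in> diff_field P"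
    "x \<in> diff_field P \<Longrightarrow> y \<in> diff_field P \<Longrightarrow> x - y \<in> diff_field P"
    "x \<in> diff_field P \<Longrightarrow> y \<in> diff_field P \<Longrightarrow> x * y \<in> diff_field P"
    "x \<in> diff_field P \<Longrightarrow> - x \<in> diff_field P"
    "x \<in> diff_field P \<Longrightarrow> inverse x \<in> diff_field P"
    "x \<in> diff_field P \<Longrightarrow> x\<^sup>2 \<in> P"
proof -
  note C = field_coneD[OF P]
  have I: "x \<in> diff_field P" if "x = a - b" "a \<in> P" "b \<in> P" for x a b
    using that by (auto simp: diff_field_def)
  have E: "\<exists>a\<in>P. \<exists>b\<in>P. x = a - b" if "x \<in> diff_field P" for x
    using that by (auto simp: diff_field_def)
  show sub: "x \<in> P \<Longrightarrow> x \<in> diff_field P" for x using I[of x x 0] C(2) by simp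
  then show "0 \<in> diff_field P" "1 \<in> diff_field P" using C by auto
  show "x + y \<in> diff_field P" if xy: "x \<in> diff_field P" "y \<in> diff_field P" for x y
  proof -
    obtain a b c d where "a \<in> P" "b \<in> P" "x = a - b" "c \<in> P" "d \<in> P" "y = c - d"
      using E[OF xy(1)] E[OF xy(2)] by blast
    then show ?thesis by (intro I[of _ "a + c" "b + d"] C) simp_all
  qed
  show "x - y \<in> diff_field P" if xy: "x \<in> diff_field P" "y \<in> diff_field P" for x y
  proof -
    obtain a b c d where "a \<in> P" "b \<in> P" "x = a - b" "c \<in> P" "d \<in> P" "y = c - d"
      using E[OF xy(1)] E[OF xy(2)] by blast
    then show ?thesis by (intro I[of _ "a + d" "b + c"] C) simp_all
  qed
  show mult: "x * y \<in> diff_field P" if xy: "x \<in> diff_field P" "y \<in> diff_field P" for x y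
  proof -
    obtain a b c d where abcd: "a \<in> P" "b \<in> P" "c \<in> P" "d \<in> P" and eq: "x = a - b" "y = c - d"
      using E[OF xy(1)] E[OF xy(2)] by blast
    have "x * y = (a * c + b * d) - (a * d + b * c)" unfolding eq by (simp add: algebra_simps)
    then show ?thesis by (rule I) (intro C abcd)+
  qed
  show "- x \<in> diff_field P" if x: "x \<in> diff_field P" for x
  proof -
    obtain a b where "a \<in> P" "b \<in> P" "x = a - b" using E[OF x] by blast
    then show ?thesis by (intro I[of _ b a]) simp_all
  qed
  show sq: "x\<^sup>2 \<in> P" if "x \<in> diff_field P" for x using E[OF that] C(7) by auto
  show "inverse x \<in> diff_field P" if "x \<in> diff_field P" for x
  proof -
    have "inverse x = x * inverse (x\<^sup>2)" by (cases "x = 0") (simp_all add: power2_eq_square)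
    then show ?thesis using mult[OF that sub[OF C(4)[OF sq[OF that]]]] by simp
  qed
qed

text \<open>If neither \<open>a\<close> nor \<open>- a\<close> is in \<open>P\<close>, then \<open>P + a P\<close> is a larger cone: a relation
  \<open>- 1 = x + a y\<close> would show that \<open>- a = (1 + x) / y\<close> is in \<open>P\<close>.\<close>

lemma max_cone_total:
  assumes "max_cone P" "a \<in> diff_field P"
  shows "a \<in> P \<or> - a \<in> P"
proof (rule ccontr)
  assume contra: "\<not> ?thesis"
  have P: "field_cone P" using assms(1) by (simp add: max_cone_def)
  note C = field_coneD[OF P] and D = diff_field_closed[OF P]
  \<comment> \<open>The cone that a would generate over P.\<close>
  define Q where "Q = {x + a * y | x y. x \<in> P \<and> y \<in> P}"
  have QI: "z \<in> Q" if "z = x + a * y" "x \<in> P" "y \<in> P" for x y z using that by (auto simp: Q_def)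
  have QE: "\<exists>x\<in>P. \<exists>y\<in>P. z = x + a * y" if "z \<in> Q" for z using that by (auto simp: Q_def)
  have QF: "z \<in> diff_field P" if "z \<in> Q" for z using QE[OF that] D(1,4,6) assms(2) by auto
  have PQ: "P \<subseteq> Q" using QI[of _ _ 0] C(2) by fastforce
  have a2: "a\<^sup>2 \<in> P" using D(9) assms(2) by blast
  have mult: "z * w \<in> Q" if zw: "z \<in> Q" "w \<in> Q" for z w
  proof -
    obtain x y x' y' where "x \<in> P" "y \<in> P" "z = x + a * y" "x' \<in> P" "y' \<in> P" "w = x' + a * y'"
      using QE[OF zw(1)] QE[OF zw(2)] by blast
    then show ?thesis
      by (intro QI[of _ "x * x' + a\<^sup>2 * (y * y')" "x * y' + y * x'"] C a2)
        (simp_all add: algebra_simps power2_eq_square)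
  qed
  have "field_cone Q"
    unfolding field_cone_def
  proof (intro conjI ballI)
    show "1 \<in> Q" using PQ C(1) by blast
    show "- 1 \<notin> Q"
    proof
      assume "- 1 \<in> Q"
      then obtain x y where xy: "x \<in> P" "y \<in> P" "- 1 = x + a * y" using QE by blast
      have "y \<noteq> 0" using xy C(3) by auto
      then have "- a = (1 + x) * inverse y" using xy(3)
        by (simp add: field_simps) (metis add.commute add_neg_numeral_special(7) add.assoc add_0 minus_unique)
      then show False using contra C xy by metis
    qed
    show "inverse z \<in> Q" if "z \<in> Q" for z
    proof -
      have "(inverse z)\<^sup>2 \<in> Q" using D(8,9) QF[OF that] PQ by blast
      moreover have "inverse z = z * (inverse z)\<^sup>2" by (cases "z = 0") (simp_all add: power2_eq_square)
      ultimately show ?thesis using mult[OF that] by metis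
    qed
    fix z w assume zw: "z \<in> Q" "w \<in> Q"
    then obtain x y x' y' where "x \<in> P" "y \<in> P" "z = x + a * y" "x' \<in> P" "y' \<in> P" "w = x' + a * y'"
      using QE by blast
    then show "z + w \<in> Q" by (intro QI[of _ "x + x'" "y + y'"] C) (simp_all add: algebra_simps)
    show "z * w \<in> Q" by (rule mult[OF zw])
    show "(z - w)\<^sup>2 \<in> Q" using D(5,9) QF zw PQ by blast
  qed
  then have "Q = P" using assms(1) PQ by (simp add: max_cone_def)
  moreover have "a \<in> Q" using QI[of a 0 1] C by simp
  ultimately show False using contra by simp
qed

section \<open>An ordered field chosen as a potential counterexample\<close>

text \<open>An algebraically closed field that contains real polynomials in any finite number of variables.
  Indexing the variables by natural numbers provides the linear order of the variables from which
  the polynomials inherit the structure of an integral domain, and a single type for all numbers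
  of variables.\<close>

type_synonym ambient = "nat mpoly fract alg_closure"

definition mconst :: "real \<Rightarrow> 'n mpoly" where
  "mconst c = Poly_Mapping.single 0 c"

lemma mconst_hom: "unital_ring_hom mconst"
  by standard (simp_all add: mconst_def single_add mult_single)

definition embed :: "nat mpoly \<Rightarrow> ambient" where
  "embed p = to_ac (to_fract p)"

lemma embed_hom: "unital_ring_hom embed"
  by standard (simp_all add: embed_def)

lemma embed_eq_0_iff: "embed p = 0 \<longleftrightarrow> p = 0"
  by (simp add: embed_def)

definition ambient_const :: "real \<Rightarrow> ambient" where
  "ambient_const c = embed (mconst c)"

lemma ambient_const_hom: "unital_ring_hom ambient_const"
proof -
  interpret e: unital_ring_hom embed by (rule embed_hom)
  interpret m: unital_ring_hom "mconst :: real \<Rightarrow> nat mpoly" by (rule mconst_hom)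
  show ?thesis
    by standard (simp_all add: ambient_const_def e.hom_add m.hom_add e.hom_mult m.hom_mult e.hom_one m.hom_one)
qed

lemma ambient_const_inverse: "ambient_const (inverse c) = inverse (ambient_const c)"
proof (cases "c = 0")
  case True
  interpret unital_ring_hom ambient_const by (rule ambient_const_hom)
  show ?thesis using True by (simp add: hom_zero)
next
  case False
  interpret unital_ring_hom ambient_const by (rule ambient_const_hom)
  have "ambient_const c * ambient_const (inverse c) = 1"
    using False by (simp add: hom_one flip: hom_mult)
  then show ?thesis by (metis inverse_unique)
qed

lemma field_cone_nonneg_reals: "field_cone (ambient_const ` {0..})"
proof -
  interpret unital_ring_hom ambient_const by (rule ambient_const_hom)
  have single_0: "Poly_Mapping.single 0 x = (0 :: nat mpoly) \<longleftrightarrow> x = 0" for x :: real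
    by (metis lookup_single_eq lookup_zero single_zero)
  have inj: "ambient_const c = ambient_const d \<longleftrightarrow> c = d" for c d
  proof -
    have "ambient_const (c - d) = 0 \<longleftrightarrow> c - d = 0"
      by (simp add: ambient_const_def embed_eq_0_iff mconst_def single_0)
    then show ?thesis by (simp add: hom_diff)
  qed
  show ?thesis
    unfolding field_cone_def
  proof (intro conjI ballI)
    show "1 \<in> ambient_const ` {0..}" by (rule image_eqI[of _ _ 1]) (simp_all add: hom_one)
    show "- 1 \<notin> ambient_const ` {0..}"
    proof
      assume "- 1 \<in> ambient_const ` {0..}"
      then obtain c where "c \<ge> 0" "ambient_const c = ambient_const (- 1)" by (auto simp: hom_minus hom_one)
      then show False using inj[of c "- 1"] by simp
    qed
    show "inverse x \<in> ambient_const ` {0..}" if "x \<in> ambient_const ` {0..}" for x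
      using that by (auto simp flip: ambient_const_inverse)
    fix x y assume "x \<in> ambient_const ` {0..}" "y \<in> ambient_const ` {0..}"
    then obtain c d where "c \<ge> 0" "d \<ge> 0" "x = ambient_const c" "y = ambient_const d" by auto
    then show "x + y \<in> ambient_const ` {0..}" "x * y \<in> ambient_const ` {0..}" "(x - y)\<^sup>2 \<in> ambient_const ` {0..}"
      by (auto simp flip: hom_add hom_mult hom_diff hom_power)
  qed
qed

text \<open>\<open>P\<close> is a counterexample to the specialisation theorem: a finite system of strict polynomial
  inequalities has a solution \<open>a\<close> in the ordered field of \<open>P\<close> but no real one.\<close>

definition unspecializable :: "ambient set \<Rightarrow> bool" where
  "unspecializable P \<longleftrightarrow> (\<exists>(V :: nat set) (a :: nat \<Rightarrow> ambient) (G :: nat mpoly set). finite V \<and> finite G \<and> (\<forall>i. a i \<in> diff_field P) \<and> (\<forall>i. i \<notin> V \<longrightarrow> a i = 1) \<and>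
     (\<forall>g\<in>G. monoid_eval ambient_const (power_product a) g \<in> P - {0}) \<and>
     \<not> (\<exists>b. \<forall>g\<in>G. monoid_eval (\<lambda>c. c) (power_product b) g > 0))"

definition real_cone :: "ambient set \<Rightarrow> bool" where
  "real_cone P \<longleftrightarrow> max_cone P \<and> ambient_const ` {0..} \<subseteq> P"

text \<open>A type cannot depend on a cone that is fixed inside a proof. The field below is therefore built
  from one globally chosen cone, which is a counterexample to the specialisation theorem if there
  is any. Showing that this cone is no counterexample proves the theorem for all cones.\<close>

definition order_cone :: "ambient set" where
  "order_cone = (SOME P. real_cone P \<and> ((\<exists>Q. real_cone Q \<and> unspecializable Q) \<longrightarrow> unspecializable P))"

lemma order_cone:
  "real_cone order_cone" "real_cone Q \<Longrightarrow> unspecializable Q \<Longrightarrow> unspecializable order_cone"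
proof -
  obtain P0 where "real_cone P0"
    using max_cone_exists[OF field_cone_nonneg_reals] by (metis real_cone_def)
  then have "\<exists>P. real_cone P \<and> ((\<exists>Q. real_cone Q \<and> unspecializable Q) \<longrightarrow> unspecializable P)" by blast
  from someI_ex[OF this]
  show "real_cone order_cone" "real_cone Q \<Longrightarrow> unspecializable Q \<Longrightarrow> unspecializable order_cone"
    unfolding order_cone_def by blast+
qed

lemma max_cone_order_cone: "max_cone order_cone" and field_cone_order_cone: "field_cone order_cone"
  using order_cone(1) by (simp_all add: real_cone_def max_cone_def)

text \<open>The ordered field of the chosen cone. Making it a type gives access to the theory of
  linearly ordered fields and of their polynomials.\<close>

typedef witness_field = "diff_field order_cone"
  using diff_field_closed(2)[OF field_cone_order_cone] by blast

setup_lifting type_definition_witness_field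

instantiation witness_field :: linordered_field
begin

lift_definition zero_witness_field :: witness_field is 0 by (rule diff_field_closed(2)[OF field_cone_order_cone])
lift_definition one_witness_field :: witness_field is 1 by (rule diff_field_closed(3)[OF field_cone_order_cone])
lift_definition plus_witness_field :: "witness_field \<Rightarrow> witness_field \<Rightarrow> witness_field" is "(+)" by (rule diff_field_closed(4)[OF field_cone_order_cone])
lift_definition minus_witness_field :: "witness_field \<Rightarrow> witness_field \<Rightarrow> witness_field" is "(-)" by (rule diff_field_closed(5)[OF field_cone_order_cone])
lift_definition times_witness_field :: "witness_field \<Rightarrow> witness_field \<Rightarrow> witness_field" is "(*)" by (rule diff_field_closed(6)[OF field_cone_order_cone])
lift_definition uminus_witness_field :: "witness_field \<Rightarrow> witness_field" is uminus by (rule diff_field_closed(7)[OF field_cone_order_cone])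
lift_definition inverse_witness_field :: "witness_field \<Rightarrow> witness_field" is inverse by (rule diff_field_closed(8)[OF field_cone_order_cone])
definition divide_witness_field :: "witness_field \<Rightarrow> witness_field \<Rightarrow> witness_field" where "divide_witness_field x y = x * inverse y"
lift_definition less_eq_witness_field :: "witness_field \<Rightarrow> witness_field \<Rightarrow> bool" is "\<lambda>x y. y - x \<in> order_cone" .
definition less_witness_field :: "witness_field \<Rightarrow> witness_field \<Rightarrow> bool" where "less_witness_field x y \<longleftrightarrow> x \<le> y \<and> x \<noteq> y"
definition abs_witness_field :: "witness_field \<Rightarrow> witness_field" where "abs_witness_field x = (if x < 0 then - x else x)"
definition sgn_witness_field :: "witness_field \<Rightarrow> witness_field" where "sgn_witness_field x = (if x = 0 then 0 else if 0 < x then 1 else - 1)"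

instance
proof
  note C = field_coneD[OF field_cone_order_cone]
  fix x y z :: witness_field
  show "x + y + z = x + (y + z)" "x + y = y + x" "0 + x = x" "- x + x = 0" "x - y = x + - y"
    "x + y - x = y" "x - y - z = x - (y + z)" "0 * x = 0" "x * 0 = 0"
    "x * y * z = x * (y * z)" "x * y = y * x" "1 * x = x" "(x + y) * z = x * z + y * z"
    by (transfer; simp add: algebra_simps)+
  show "(0 :: witness_field) \<noteq> 1" by transfer simp
  show "x \<noteq> 0 \<Longrightarrow> inverse x * x = 1" by transfer simp
  show "x div y = x * inverse y" by (simp add: divide_witness_field_def)
  show "inverse (0 :: witness_field) = 0" by transfer simp
  show refl: "x \<le> x" by transfer (simp add: C)
  show "x \<le> y \<Longrightarrow> y \<le> z \<Longrightarrow> x \<le> z"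
  proof transfer
    fix x y z :: ambient assume "y - x \<in> order_cone" "z - y \<in> order_cone"
    then have "(y - x) + (z - y) \<in> order_cone" by (rule C(5))
    then show "z - x \<in> order_cone" by simp
  qed
  show antisym: "x \<le> y \<Longrightarrow> y \<le> x \<Longrightarrow> x = y"
  proof transfer
    fix x y :: ambient assume "y - x \<in> order_cone" "x - y \<in> order_cone"
    then show "x = y" using cone_pointed[OF field_cone_order_cone, of "y - x"] by simp
  qed
  show total: "x \<le> y \<or> y \<le> x"
  proof transfer
    fix x y assume "x \<in> diff_field order_cone" "y \<in> diff_field order_cone"
    then have "y - x \<in> diff_field order_cone" by (intro diff_field_closed(5)[OF field_cone_order_cone])
    from max_cone_total[OF max_cone_order_cone this]
    show "y - x \<in> order_cone \<or> x - y \<in> order_cone" by simp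
  qed
  show "(x < y) = (x \<le> y \<and> \<not> y \<le> x)"
    unfolding less_witness_field_def using refl antisym by auto
  show "x \<le> y \<Longrightarrow> z + x \<le> z + y" by transfer simp
  show "x < y \<Longrightarrow> 0 < z \<Longrightarrow> z * x < z * y"
  proof -
    assume "x < y" "0 < z"
    then have le: "x \<le> y" "0 \<le> z" and ne: "x \<noteq> y" "z \<noteq> 0" by (auto simp: less_witness_field_def)
    have "z * x \<le> z * y" using le
    proof transfer
      fix x y z assume "y - x \<in> order_cone" "z - 0 \<in> order_cone"
      then have "z * (y - x) \<in> order_cone" by (simp add: C(6))
      then show "z * y - z * x \<in> order_cone" by (simp add: algebra_simps)
    qed
    moreover have "z * x \<noteq> z * y" using ne by transfer simp
    ultimately show ?thesis by (simp add: less_witness_field_def)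
  qed
  show "\<bar>x\<bar> = (if x < 0 then - x else x)" by (simp add: abs_witness_field_def)
  show "sgn x = (if x = 0 then 0 else if 0 < x then 1 else - 1)" by (simp add: sgn_witness_field_def)
qed

end

lemma Rep_witness_field_hom: "unital_ring_hom Rep_witness_field"
  by standard (simp_all add: plus_witness_field.rep_eq times_witness_field.rep_eq one_witness_field.rep_eq)

lemma nonneg_witness_field_iff: "0 \<le> x \<longleftrightarrow> Rep_witness_field x \<in> order_cone"
  by (simp add: less_eq_witness_field.rep_eq zero_witness_field.rep_eq)

section \<open>The chosen field is real closed, so positivity specialises\<close>

text \<open>Values of these polynomials at \<open>\<alpha>\<close> are the elements that must be nonnegative in any extension of the
  order to the field generated by \<open>\<alpha>\<close>.\<close>

inductive_set weighted_squares :: "'a::linordered_field poly set" where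
  zero: "0 \<in> weighted_squares"
| add: "w \<in> weighted_squares \<Longrightarrow> c \<ge> 0 \<Longrightarrow> w + smult c (u\<^sup>2) \<in> weighted_squares"

lemma weighted_square: "c \<ge> 0 \<Longrightarrow> smult c (u\<^sup>2) \<in> weighted_squares"
  using weighted_squares.add[OF weighted_squares.zero] by simp

lemma square_in_weighted_squares: "u\<^sup>2 \<in> weighted_squares"
  using weighted_square[of 1 u] by simp

lemma const_in_weighted_squares: "c \<ge> 0 \<Longrightarrow> [:c:] \<in> weighted_squares"
  using weighted_square[of c 1] by (simp add: smult_one)

lemma weighted_squares_add:
  assumes "v \<in> weighted_squares" "w \<in> weighted_squares"
  shows "v + w \<in> weighted_squares"
  using assms(2)
proof induction
  case zero
  then show ?case using assms(1) by simp
next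
  case (add w c u)
  then show ?case using weighted_squares.add[of "v + w" c u] by (simp add: add.assoc)
qed

lemma weighted_squares_mult:
  assumes "v \<in> weighted_squares" "w \<in> weighted_squares"
  shows "v * w \<in> weighted_squares"
  using assms(1)
proof induction
  case zero
  then show ?case by (simp add: weighted_squares.zero)
next
  case (add v c u)
  have "smult c (u\<^sup>2) * w \<in> weighted_squares"
    using assms(2)
  proof induction
    case zero
    then show ?case by (simp add: weighted_squares.zero)
  next
    case (add w d t)
    have "smult c (u\<^sup>2) * (w + smult d (t\<^sup>2)) = smult c (u\<^sup>2) * w + smult (c * d) ((u * t)\<^sup>2)"
      by (simp add: algebra_simps power_mult_distrib)
    then show ?case using add \<open>c \<ge> 0\<close> by (simp add: weighted_squares.add)
  qed
  then show ?case using add.IH by (simp add: distrib_right weighted_squares_add)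
qed

text \<open>Reducing each square modulo \<open>\<mu>\<close> bounds the degree while the polynomial remains
  nonnegative everywhere. The bound \<open>2 * (degree \<mu> - 1)\<close> makes the cofactor of \<open>\<mu>\<close>
  in \<open>witness_field_root_between\<close> drop below the degree of \<open>\<mu>\<close>.\<close>

lemma weighted_squares_reduce:
  assumes "w \<in> weighted_squares" "degree \<mu> > 0"
  shows "\<exists>v. \<mu> dvd w - v \<and> (\<forall>x. poly v x \<ge> 0) \<and> degree v \<le> 2 * (degree \<mu> - 1)"
  using assms(1)
proof induction
  case zero
  then show ?case by (intro exI[of _ 0]) simp
next
  case (add w c u)
  then obtain v where v: "\<mu> dvd w - v" "\<And>x. poly v x \<ge> 0" "degree v \<le> 2 * (degree \<mu> - 1)" by blast
  define r where "r = u mod \<mu>"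
  have "\<mu> \<noteq> 0" using assms(2) by auto
  then have deg: "degree r \<le> degree \<mu> - 1"
    using degree_mod_less[of \<mu> u] assms(2) unfolding r_def by force
  have "\<mu> dvd u - r" by (simp add: r_def minus_mod_eq_mult_div)
  then have "\<mu> dvd (u - r) * (u + r)" by (rule dvd_mult2)
  then have "\<mu> dvd smult c (u\<^sup>2 - r\<^sup>2)" by (intro dvd_smult) (simp add: power2_eq_square algebra_simps)
  from dvd_add[OF v(1) this] have "\<mu> dvd w + smult c (u\<^sup>2) - (v + smult c (r\<^sup>2))"
    by (simp add: algebra_simps smult_diff_right)
  moreover have "poly (v + smult c (r\<^sup>2)) x \<ge> 0" for x using v(2) add.hyps by simp
  moreover have "degree (v + smult c (r\<^sup>2)) \<le> 2 * (degree \<mu> - 1)"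
  proof (rule degree_add_le[OF v(3)])
    have "degree (smult c (r\<^sup>2)) \<le> degree (r\<^sup>2)" by (rule degree_smult_le)
    also have "\<dots> \<le> degree r * 2" by (rule degree_power_le)
    finally show "degree (smult c (r\<^sup>2)) \<le> 2 * (degree \<mu> - 1)" using deg by simp
  qed
  ultimately show ?case by blast
qed

definition eval_at :: "ambient \<Rightarrow> witness_field poly \<Rightarrow> ambient" where
  "eval_at \<alpha> q = poly (map_poly Rep_witness_field q) \<alpha>"

interpretation Rep_witness_field: unital_ring_hom Rep_witness_field by (rule Rep_witness_field_hom)

lemma eval_at_hom: "unital_ring_hom (eval_at \<alpha>)"
  by standard (simp_all add: eval_at_def Rep_witness_field.map_poly_hom_add Rep_witness_field.map_poly_hom_mult Rep_witness_field.hom_one)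

lemma eval_at_const: "eval_at \<alpha> [:c:] = Rep_witness_field c"
  by (simp add: eval_at_def map_poly_pCons Rep_witness_field.hom_zero)

lemma eval_at_Rep_witness_field: "eval_at (Rep_witness_field r) p = Rep_witness_field (poly p r)"
  by (induction p) (simp_all add: eval_at_def map_poly_pCons Rep_witness_field.hom_zero Rep_witness_field.hom_add Rep_witness_field.hom_mult)

lemma minimal_polynomial_exists:
  assumes "p \<noteq> 0" "eval_at \<alpha> p = 0"
  obtains \<mu> where "degree \<mu> > 0" "eval_at \<alpha> \<mu> = 0"
    "\<And>f. f \<noteq> 0 \<Longrightarrow> eval_at \<alpha> f = 0 \<Longrightarrow> degree \<mu> \<le> degree f"
    "\<And>f. eval_at \<alpha> f = 0 \<Longrightarrow> \<mu> dvd f"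
proof -
  interpret ev: unital_ring_hom "eval_at \<alpha>" by (rule eval_at_hom)
  obtain \<mu> where \<mu>: "\<mu> \<noteq> 0" "eval_at \<alpha> \<mu> = 0"
    and min: "\<And>f. f \<noteq> 0 \<Longrightarrow> eval_at \<alpha> f = 0 \<Longrightarrow> degree \<mu> \<le> degree f"
    using ex_has_least_nat[of "\<lambda>f. f \<noteq> 0 \<and> eval_at \<alpha> f = 0" p degree] assms by blast
  have "degree \<mu> > 0"
  proof (rule ccontr)
    assume "\<not> ?thesis"
    then obtain c where "\<mu> = [:c:]" by (metis degree_eq_zeroE neq0_conv)
    then have "Rep_witness_field c = 0" "c \<noteq> 0" using \<mu> by (auto simp: eval_at_const)
    then show False using Rep_witness_field_inject Rep_witness_field.hom_zero by metis
  qed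
  moreover have "\<mu> dvd f" if "eval_at \<alpha> f = 0" for f
  proof (rule ccontr)
    assume ndvd: "\<not> \<mu> dvd f"
    have "eval_at \<alpha> (f mod \<mu>) = eval_at \<alpha> f - eval_at \<alpha> (f div \<mu>) * eval_at \<alpha> \<mu>"
      by (simp flip: ev.hom_mult ev.hom_diff add: minus_div_mult_eq_mod)
    then have "eval_at \<alpha> (f mod \<mu>) = 0" using that \<mu> by simp
    moreover have "f mod \<mu> \<noteq> 0" using ndvd by (simp add: dvd_eq_mod_eq_0)
    ultimately show False using min[of "f mod \<mu>"] degree_mod_less_degree[OF \<mu>(1) ndvd] by simp
  qed
  ultimately show ?thesis using that \<mu> min by blast
qed

text \<open>Polynomial expressions in an algebraic element form a field: dividing the minimal polynomial by
  \<open>q\<close> replaces \<open>q\<close> by a remainder of smaller degree.\<close>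

lemma eval_at_inverse:
  assumes \<mu>: "degree \<mu> > 0" "eval_at \<alpha> \<mu> = 0"
    and min: "\<And>f. f \<noteq> 0 \<Longrightarrow> eval_at \<alpha> f = 0 \<Longrightarrow> degree \<mu> \<le> degree f"
    and "eval_at \<alpha> q \<noteq> 0"
  shows "\<exists>s. eval_at \<alpha> q * eval_at \<alpha> s = 1"
proof -
  interpret ev: unital_ring_hom "eval_at \<alpha>" by (rule eval_at_hom)
  have small: "\<exists>s. eval_at \<alpha> q * eval_at \<alpha> s = 1" if "q \<noteq> 0" "degree q < degree \<mu>" for q
    using that
  proof (induction "degree q" arbitrary: q rule: less_induct)
    case less
    have q0: "eval_at \<alpha> q \<noteq> 0" using min less.prems by fastforce
    show ?case
    proof (cases "degree q = 0")
      case True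
      then obtain c where c: "q = [:c:]" by (metis degree_eq_zeroE)
      with less.prems have "q * [:1 / c:] = 1" by (simp add: one_pCons)
      then show ?thesis by (metis ev.hom_mult ev.hom_one)
    next
      case False
      define r where "r = \<mu> mod q"
      have eq: "eval_at \<alpha> r = - (eval_at \<alpha> (\<mu> div q) * eval_at \<alpha> q)"
      proof -
        have "eval_at \<alpha> (\<mu> div q) * eval_at \<alpha> q + eval_at \<alpha> r = eval_at \<alpha> \<mu>"
          by (simp only: ev.hom_add[symmetric] ev.hom_mult[symmetric] r_def div_mult_mod_eq)
        then show ?thesis using \<mu>(2) by (simp add: add_eq_0_iff)
      qed
      have "r \<noteq> 0"
      proof
        assume r0: "r = 0"
        then have \<mu>eq: "\<mu> = (\<mu> div q) * q" using div_mult_mod_eq[of \<mu> q] by (simp add: r_def)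
        have "eval_at \<alpha> (\<mu> div q) = 0" using eq r0 q0 by (simp add: ev.hom_zero)
        moreover have "\<mu> div q \<noteq> 0" using \<mu>eq \<mu>(1) by auto
        ultimately have "degree \<mu> \<le> degree (\<mu> div q)" using min by blast
        moreover have "degree \<mu> = degree (\<mu> div q) + degree q"
          using \<open>\<mu> div q \<noteq> 0\<close> less.prems(1) by (subst \<mu>eq) (rule degree_mult_eq)
        ultimately show False using False by simp
      qed
      moreover have "degree r < degree q"
        using degree_mod_less[OF less.prems(1), of \<mu>] \<open>r \<noteq> 0\<close> by (simp add: r_def)
      ultimately obtain s where "eval_at \<alpha> r * eval_at \<alpha> s = 1"
        using less.hyps[of r] less.prems(2) by auto
      then have "eval_at \<alpha> q * eval_at \<alpha> (- (\<mu> div q) * s) = 1"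
        by (simp add: eq ev.hom_mult ev.hom_minus mult_ac)
      then show ?thesis by blast
    qed
  qed
  have "eval_at \<alpha> (q mod \<mu>) = eval_at \<alpha> q - eval_at \<alpha> (q div \<mu>) * eval_at \<alpha> \<mu>"
    by (simp flip: ev.hom_mult ev.hom_diff add: minus_div_mult_eq_mod)
  then have eq: "eval_at \<alpha> (q mod \<mu>) = eval_at \<alpha> q" using \<mu>(2) by simp
  then have ne: "q mod \<mu> \<noteq> 0" using assms(4) by (auto simp: ev.hom_zero)
  then have "degree (q mod \<mu>) < degree \<mu>"
    using degree_mod_less[of \<mu> q] \<mu>(1) by fastforce
  from small[OF ne this] show ?thesis by (simp add: eq)
qed

text \<open>For inverses: \<open>1/x\<close> is again a polynomial expression in \<open>\<alpha>\<close>, and \<open>1/x = x (1/x)\<^sup>2\<close>.\<close>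

lemma field_cone_extension:
  assumes \<mu>: "degree \<mu> > 0" "eval_at \<alpha> \<mu> = 0"
    and min: "\<And>f. f \<noteq> 0 \<Longrightarrow> eval_at \<alpha> f = 0 \<Longrightarrow> degree \<mu> \<le> degree f"
    and neg: "- 1 \<notin> eval_at \<alpha> ` weighted_squares"
  shows "field_cone (eval_at \<alpha> ` weighted_squares)"
proof -
  interpret ev: unital_ring_hom "eval_at \<alpha>" by (rule eval_at_hom)
  let ?Q = "eval_at \<alpha> ` weighted_squares"
  show ?thesis
    unfolding field_cone_def
  proof (intro conjI ballI neg)
    show "1 \<in> ?Q"
      using square_in_weighted_squares[of 1] by (intro image_eqI[of _ _ 1]) (simp_all add: ev.hom_one)
    show "inverse x \<in> ?Q" if x: "x \<in> ?Q" for x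
    proof (cases "x = 0")
      case True
      then show ?thesis using x by simp
    next
      case False
      obtain w where w: "w \<in> weighted_squares" "x = eval_at \<alpha> w" using x by blast
      then obtain s where s: "x * eval_at \<alpha> s = 1" using eval_at_inverse[OF \<mu> min] False by blast
      then have "inverse x = eval_at \<alpha> s" by (rule inverse_unique)
      then have "inverse x = eval_at \<alpha> (w * s\<^sup>2)"
        using s by (simp add: ev.hom_mult ev.hom_power w(2) power2_eq_square flip: mult.assoc)
      then show ?thesis
        using weighted_squares_mult[OF w(1) square_in_weighted_squares] by blast
    qed
    fix x y assume "x \<in> ?Q" "y \<in> ?Q"
    then obtain v w where vw: "v \<in> weighted_squares" "w \<in> weighted_squares" "x = eval_at \<alpha> v" "y = eval_at \<alpha> w"
      by blast
    show "x + y \<in> ?Q" using vw weighted_squares_add by (metis ev.hom_add imageI)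
    show "x * y \<in> ?Q" using vw weighted_squares_mult by (metis ev.hom_mult imageI)
    show "(x - y)\<^sup>2 \<in> ?Q" using vw square_in_weighted_squares by (metis ev.hom_diff ev.hom_power imageI)
  qed
qed

text \<open>Otherwise the weighted squares would extend the cone to a field containing \<open>\<alpha>\<close>, against
  maximality. Note that \<open>\<alpha>\<close> is itself a difference of squares,
  \<open>\<alpha> = ((\<alpha> + 1)/2)\<^sup>2 - ((\<alpha> - 1)/2)\<^sup>2\<close>.\<close>

lemma minus_one_is_weighted_square:
  assumes \<mu>: "degree \<mu> > 0" "eval_at \<alpha> \<mu> = 0"
    and min: "\<And>f. f \<noteq> 0 \<Longrightarrow> eval_at \<alpha> f = 0 \<Longrightarrow> degree \<mu> \<le> degree f"
    and out: "\<alpha> \<notin> range Rep_witness_field"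
  shows "- 1 \<in> eval_at \<alpha> ` weighted_squares"
proof (rule ccontr)
  assume neg: "\<not> ?thesis"
  interpret ev: unital_ring_hom "eval_at \<alpha>" by (rule eval_at_hom)
  let ?Q = "eval_at \<alpha> ` weighted_squares"
  have cone: "field_cone ?Q" using field_cone_extension[OF \<mu> min neg] .
  have "order_cone \<subseteq> ?Q"
  proof
    fix x assume x: "x \<in> order_cone"
    then have "x \<in> diff_field order_cone" by (rule diff_field_closed(1)[OF field_cone_order_cone])
    then obtain r where r: "x = Rep_witness_field r" using Rep_witness_field_cases by blast
    then have "0 \<le> r" using x by (simp add: nonneg_witness_field_iff)
    then show "x \<in> ?Q" using const_in_weighted_squares r eval_at_const by (metis imageI)
  qed
  then have Q: "?Q = order_cone" using max_cone_order_cone cone by (simp add: max_cone_def)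
  \<comment> \<open>These halves express the variable as a difference of two squares.\<close>
  define u v :: "witness_field poly" where "u = [:1 / 2, 1 / 2:]" and "v = [:- 1 / 2, 1 / 2:]"
  have "u\<^sup>2 - v\<^sup>2 = [:0, 1:]" by (simp add: u_def v_def power2_eq_square)
  then have "eval_at \<alpha> (u\<^sup>2) - eval_at \<alpha> (v\<^sup>2) = \<alpha>"
    by (simp flip: ev.hom_diff) (simp add: eval_at_def map_poly_pCons Rep_witness_field.hom_zero Rep_witness_field.hom_one)
  moreover have "eval_at \<alpha> (u\<^sup>2) \<in> order_cone" "eval_at \<alpha> (v\<^sup>2) \<in> order_cone"
    using square_in_weighted_squares Q by blast+
  ultimately have "\<alpha> \<in> diff_field order_cone" unfolding diff_field_def by force
  then show False using out Rep_witness_field_cases by blast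
qed

text \<open>Artin and Schreier's descent. Let \<open>\<alpha>\<close> be a root of \<open>p\<close> in the algebraic closure with minimal
  polynomial \<open>\<mu>\<close>. If \<open>\<alpha>\<close> is not in the field, then \<open>- 1\<close> is a sum of weighted squares at \<open>\<alpha>\<close>,
  which lifts to \<open>1 + v = \<mu> q\<close> with \<open>v\<close> nonnegative and \<open>q\<close> of smaller degree than \<open>\<mu>\<close>.
  As \<open>\<mu> q\<close> is positive everywhere, a sign change of \<open>\<mu>\<close> is one of \<open>q\<close>; by induction \<open>q\<close>
  has a root, where \<open>\<mu> q\<close> would vanish. If \<open>\<alpha>\<close> is in the field, or if \<open>\<mu>\<close> does not change
  sign, a factor can be split off.\<close>

lemma witness_field_root_between:
  fixes p :: "witness_field poly"
  assumes "a < b" "poly p a * poly p b < 0"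
  shows "\<exists>x. a < x \<and> x < b \<and> poly p x = 0"
  using assms(2)
proof (induction "degree p" arbitrary: p rule: less_induct)
  case less
  have p0: "p \<noteq> 0" using less.prems by auto
  have neg_factor: "y < 0" if "x * y < 0" "x > 0" for x y :: witness_field
    using that by (simp add: mult_less_0_iff)
  have neg_factor': "y < 0" if "x * y > 0" "x < 0" for x y :: witness_field
    using that by (simp add: zero_less_mult_iff)
  have factor: ?case if "p = f * g" "degree g < degree p" "poly f a * poly f b > 0" for f g
  proof -
    have "(poly f a * poly f b) * (poly g a * poly g b) < 0" using less.prems that(1) by (simp add: mult_ac)
    then have "poly g a * poly g b < 0" using that(3) by (rule neg_factor)
    then show ?thesis using less.hyps[OF that(2)] that(1) by auto
  qed
  have "degree p > 0"
  proof (rule ccontr)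
    assume "\<not> degree p > 0"
    then obtain c where "p = [:c:]" by (metis degree_eq_zeroE neq0_conv)
    then show False using less.prems by (simp add: mult_less_0_iff)
  qed
  have inj: "Rep_witness_field c = 0 \<longleftrightarrow> c = 0" for c using Rep_witness_field_inject[of c 0] by (simp add: Rep_witness_field.hom_zero)
  have "degree (map_poly Rep_witness_field p) = degree p"
    using p0 by (intro map_poly_degree_eq) (simp add: inj)
  then obtain \<alpha> where "poly (map_poly Rep_witness_field p) \<alpha> = 0"
    using alg_closed_imp_poly_has_root[of "map_poly Rep_witness_field p"] \<open>degree p > 0\<close> by auto
  then have \<alpha>: "eval_at \<alpha> p = 0" by (simp add: eval_at_def)
  show ?case
  proof (cases "\<alpha> \<in> range Rep_witness_field")
    case True
    then obtain r where r: "poly p r = 0" using \<alpha> by (auto simp: eval_at_Rep_witness_field inj)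
    then obtain g where g: "p = [:- r, 1:] * g" by (auto simp: poly_eq_0_iff_dvd)
    have "g \<noteq> 0" using g p0 by auto
    have "degree p = Suc (degree g)" unfolding g using \<open>g \<noteq> 0\<close> by (subst degree_mult_eq) auto
    show ?thesis
    proof (cases "a < r \<and> r < b")
      case False
      have "r \<noteq> a" "r \<noteq> b" using r less.prems by auto
      with False have "(a - r) * (b - r) > 0" using assms(1)
        by (auto simp: not_less zero_less_mult_iff)
      then show ?thesis using factor[OF g] \<open>degree p = Suc (degree g)\<close> by (simp add: mult.commute)
    qed (use r in blast)
  next
    case out: False
    obtain \<mu> where \<mu>: "degree \<mu> > 0" "eval_at \<alpha> \<mu> = 0"
      and min: "\<And>f. f \<noteq> 0 \<Longrightarrow> eval_at \<alpha> f = 0 \<Longrightarrow> degree \<mu> \<le> degree f"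
      and dvd: "\<And>f. eval_at \<alpha> f = 0 \<Longrightarrow> \<mu> dvd f"
      using minimal_polynomial_exists[OF p0 \<alpha>] by metis
    interpret ev: unital_ring_hom "eval_at \<alpha>" by (rule eval_at_hom)
    obtain w where w: "w \<in> weighted_squares" "eval_at \<alpha> w = - 1"
      using minus_one_is_weighted_square[OF \<mu> min out] by force
    obtain v where v: "\<mu> dvd w - v" "\<And>x. poly v x \<ge> 0" "degree v \<le> 2 * (degree \<mu> - 1)"
      using weighted_squares_reduce[OF w(1) \<mu>(1)] by blast
    \<comment> \<open>Replacing w by its reduction v keeps divisibility by the minimal polynomial.\<close>
    have "\<mu> dvd 1 + w" using w(2) by (intro dvd) (simp add: ev.hom_add ev.hom_one)
    then have "\<mu> dvd (1 + w) - (w - v)" using v(1) by (rule dvd_diff)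
    then have "\<mu> dvd 1 + v" by (simp add: algebra_simps)
    then obtain q where q: "1 + v = \<mu> * q" by (auto elim: dvdE)
    have pos: "poly (\<mu> * q) x > 0" for x using v(2)[of x] by (simp flip: q add: add_pos_nonneg)
    have "\<mu> \<noteq> 0" "q \<noteq> 0" using pos[of 0] by auto
    then have "degree \<mu> + degree q = degree (1 + v)" by (simp add: q degree_mult_eq)
    also have "\<dots> \<le> 2 * (degree \<mu> - 1)" using v(3) by (intro degree_add_le) auto
    finally have qdeg: "degree q < degree \<mu>" using \<mu>(1) by linarith
    obtain s where s: "p = \<mu> * s" using dvd[OF \<alpha>] by (auto elim: dvdE)
    have "s \<noteq> 0" using s p0 by auto
    then have deg: "degree p = degree \<mu> + degree s" unfolding s using \<open>\<mu> \<noteq> 0\<close> by (rule degree_mult_eq[rotated])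
    show ?thesis
    proof (cases "poly \<mu> a * poly \<mu> b > 0")
      case True
      then show ?thesis using factor[OF s] deg \<mu>(1) by simp
    next
      case False
      have "poly \<mu> a \<noteq> 0" "poly \<mu> b \<noteq> 0" using pos[of a] pos[of b] by auto
      then have neg: "poly \<mu> a * poly \<mu> b < 0" using False by (simp add: not_less order_le_less)
      have "(poly \<mu> a * poly \<mu> b) * (poly q a * poly q b) > 0"
        using mult_pos_pos[OF pos[of a] pos[of b]] by (simp add: mult_ac)
      then have "poly q a * poly q b < 0" using neg by (rule neg_factor')
      then obtain x where "poly q x = 0" using less.hyps[of q] qdeg deg by force
      then show ?thesis using pos[of x] by simp
    qed
  qed
qed

instance witness_field :: real_closed_field
proof
  fix a b :: witness_field and n :: nat and f :: "nat \<Rightarrow> witness_field"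
  assume ab: "a < b" "(\<Sum>k\<le>n. f k * a ^ k) < 0" "(\<Sum>k\<le>n. f k * b ^ k) > 0"
  define p where "p = (\<Sum>k\<le>n. monom (f k) k)"
  have p: "poly p x = (\<Sum>k\<le>n. f k * x ^ k)" for x by (simp add: p_def poly_sum poly_monom)
  then have "poly p a * poly p b < 0" using ab by (simp add: mult_neg_pos)
  from witness_field_root_between[OF ab(1) this]
  show "\<exists>x. a < x \<and> x < b \<and> (\<Sum>k\<le>n. f k * x ^ k) = 0" by (simp add: p)
qed

text \<open>A version of the Artin-Lang theorem: a system of strict inequalities that is solvable in some
  ordered extension field of the reals is solvable in the reals. If this failed for some cone, it would
  fail for the chosen one, but sign conditions transfer from its real closed field to the reals.\<close>

theorem cone_specializes:
  fixes G :: "nat mpoly set"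
  assumes P: "real_cone P" and V: "finite V" "\<And>i. i \<notin> V \<Longrightarrow> a i = 1"
    and a: "\<And>i. a i \<in> diff_field P" and G: "finite G"
    and pos: "\<And>g. g \<in> G \<Longrightarrow> monoid_eval ambient_const (power_product a) g \<in> P - {0}"
  shows "\<exists>b. \<forall>g\<in>G. monoid_eval (\<lambda>c :: real. c) (power_product b) g > 0"
proof (rule ccontr)
  assume none: "\<not> ?thesis"
  have "unspecializable P" unfolding unspecializable_def
    by (intro exI[of _ V] exI[of _ a] exI[of _ G] conjI) (use V a G pos none in blast)+
  then have "unspecializable order_cone" using order_cone(2) P by blast
  then obtain V a and G :: "nat mpoly set" where V: "finite V" "\<And>i. i \<notin> V \<Longrightarrow> a i = 1" and G: "finite G"
    and a: "\<And>i. a i \<in> diff_field order_cone"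
    and pos: "\<And>g. g \<in> G \<Longrightarrow> monoid_eval ambient_const (power_product a) g \<in> order_cone - {0}"
    and bad: "\<not> (\<exists>b. \<forall>g\<in>G. monoid_eval (\<lambda>c. c) (power_product b) g > 0)"
    unfolding unspecializable_def by (elim exE conjE) (simp only: Ball_def, blast)
  \<comment> \<open>Every real is a difference of nonnegative ones, so the reals embed in the chosen field.\<close>
  have const: "ambient_const c \<in> diff_field order_cone" for c
  proof -
    interpret unital_ring_hom ambient_const by (rule ambient_const_hom)
    have "ambient_const (max c 0) \<in> order_cone" "ambient_const (max (- c) 0) \<in> order_cone"
      using order_cone(1) by (auto simp: real_cone_def)
    moreover have "ambient_const c = ambient_const (max c 0) - ambient_const (max (- c) 0)"
      by (simp add: max_def flip: hom_diff)
    ultimately show ?thesis unfolding diff_field_def by blast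
  qed
  define h where "h c = Abs_witness_field (ambient_const c)" for c
  define a' where "a' i = Abs_witness_field (a i)" for i
  have Rh: "Rep_witness_field (h c) = ambient_const c" and Ra: "Rep_witness_field (a' i) = a i" for c i
    by (simp_all add: h_def a'_def Abs_witness_field_inverse const a)
  have h: "unital_ring_hom h"
  proof -
    interpret unital_ring_hom ambient_const by (rule ambient_const_hom)
    show ?thesis
      by standard (simp_all add: Rh hom_add hom_mult hom_one plus_witness_field.rep_eq times_witness_field.rep_eq one_witness_field.rep_eq
          flip: Rep_witness_field_inject)
  qed
  have prod: "Rep_witness_field (prod f S) = (\<Prod>i\<in>S. Rep_witness_field (f i))" for f and S :: "nat set"
    by (induction S rule: infinite_finite_induct) (simp_all add: Rep_witness_field.hom_one Rep_witness_field.hom_mult)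
  have eval: "Rep_witness_field (monoid_eval h (power_product a') g) = monoid_eval ambient_const (power_product a) g" for g
    by (simp add: monoid_eval_def power_product_def Rep_witness_field.hom_sum Rep_witness_field.hom_mult Rep_witness_field.hom_power prod Rh Ra)
  have "monoid_eval h (power_product a') g > 0" if "g \<in> G" for g
  proof -
    have "monoid_eval h (power_product a') g \<ge> 0" using pos[OF that] by (simp add: nonneg_witness_field_iff eval)
    moreover have "monoid_eval h (power_product a') g \<noteq> 0"
      using pos[OF that] Rep_witness_field.hom_zero by (metis DiffD2 eval singletonI)
    ultimately show ?thesis by simp
  qed
  moreover have "a' i = 1" if "i \<notin> V" for i
    using V(2)[OF that] Ra[of i] by (simp add: one_witness_field.rep_eq flip: Rep_witness_field_inject)
  then obtain b where "\<forall>g\<in>G. same_sign (monoid_eval h (power_product a') g) (monoid_eval (\<lambda>c. c) (power_product b) g)"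
    using transfer_to_real[OF h V(1) G] by blast
  ultimately have "\<forall>g\<in>G. monoid_eval (\<lambda>c. c) (power_product b) g > 0" by (auto simp: same_sign_def)
  then show False using bad by blast
qed

section \<open>Pointed cones of polynomials are positive at a real point\<close>

definition mvar :: "'n \<Rightarrow> 'n mpoly" where
  "mvar i = Poly_Mapping.single (Poly_Mapping.single i 1) 1"

lemma mvar_power: "mvar i ^ k = Poly_Mapping.single (Poly_Mapping.single i k) 1"
  by (induction k) (simp_all add: mvar_def mult_single flip: single_add)

lemma power_product_mvar: "power_product mvar m = Poly_Mapping.single m 1"
proof -
  have "(\<Prod>i\<in>S. mvar i ^ f i) = Poly_Mapping.single (\<Sum>i\<in>S. Poly_Mapping.single i (f i)) 1"
    if "finite S" for S :: "'a set" and f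
    using that by (induction S) (simp_all add: mvar_power mult_single)
  moreover have "(\<Sum>i\<in>Poly_Mapping.keys m. Poly_Mapping.single i (Poly_Mapping.lookup m i)) = m"
    by (rule poly_mapping_eqI) (auto simp: lookup_sum lookup_single when_def in_keys_iff)
  ultimately show ?thesis by (simp add: power_product_def)
qed

lemma (in unital_ring_hom) hom_prod: "\<phi> (prod f S) = (\<Prod>x\<in>S. \<phi> (f x))"
  by (induction S rule: infinite_finite_induct) (simp_all add: hom_one hom_mult)

text \<open>Polynomial rings are generated by constants and variables; used to identify composed evaluations.\<close>

lemma mpoly_hom_eqI:
  fixes \<phi> \<psi> :: "'n mpoly \<Rightarrow> 'r::comm_ring_1"
  assumes "unital_ring_hom \<phi>" "unital_ring_hom \<psi>"
    and "\<And>c. \<phi> (mconst c) = \<psi> (mconst c)" "\<And>i. \<phi> (mvar i) = \<psi> (mvar i)"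
  shows "\<phi> p = \<psi> p"
proof -
  interpret \<phi>: unital_ring_hom \<phi> by fact
  interpret \<psi>: unital_ring_hom \<psi> by fact
  show ?thesis
  proof (induction p rule: mpoly_induct)
    case (single m c)
    have "Poly_Mapping.single m c = mconst c * power_product mvar m"
      by (simp add: power_product_mvar mconst_def mult_single)
    then show ?case
      by (simp add: power_product_def \<phi>.hom_mult \<psi>.hom_mult \<phi>.hom_prod \<psi>.hom_prod
          \<phi>.hom_power \<psi>.hom_power assms)
  qed (simp add: \<phi>.hom_add \<psi>.hom_add)
qed

lemma unital_ring_hom_comp:
  assumes "unital_ring_hom \<phi>" "unital_ring_hom \<psi>"
  shows "unital_ring_hom (\<lambda>x. \<psi> (\<phi> x))"
proof -
  interpret \<phi>: unital_ring_hom \<phi> by fact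
  interpret \<psi>: unital_ring_hom \<psi> by fact
  show ?thesis by standard (simp_all add: \<phi>.hom_add \<psi>.hom_add \<phi>.hom_mult \<psi>.hom_mult \<phi>.hom_one \<psi>.hom_one)
qed

lemma monoid_eval_mconst: "unital_ring_hom h \<Longrightarrow> monoid_eval h (power_product a) (mconst c) = h c"
  by (simp add: mconst_def monoid_eval_single)

lemma monoid_eval_mvar: "unital_ring_hom h \<Longrightarrow> monoid_eval h (power_product a) (mvar i) = a i"
  by (simp add: mvar_def monoid_eval_single unital_ring_hom.hom_one power_product_def)

lemma id_hom: "unital_ring_hom (\<lambda>x. x)"
  by standard simp_all

definition var_index :: "'n::finite \<Rightarrow> nat" where
  "var_index = (SOME e. inj e)"

lemma inj_var_index: "inj var_index"
proof -
  have "\<exists>e :: 'n::finite \<Rightarrow> nat. inj e" using finite_imp_inj_to_nat_seg[of "UNIV :: 'n set"] by auto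
  then show ?thesis unfolding var_index_def by (rule someI_ex)
qed

text \<open>A finite index type carries no linear order, so the polynomial ring over it is moved into the one with
  variables indexed by natural numbers.\<close>

definition rename :: "'n::finite mpoly \<Rightarrow> nat mpoly" where
  "rename = monoid_eval mconst (power_product (\<lambda>i. mvar (var_index i)))"

lemma rename_hom: "unital_ring_hom rename"
  unfolding rename_def by (rule power_product_eval_hom[OF mconst_hom])

lemma rename_mconst: "rename (mconst c) = mconst c"
  by (simp add: rename_def monoid_eval_mconst mconst_hom)

lemma rename_mvar: "rename (mvar i) = mvar (var_index i)"
  by (simp add: rename_def monoid_eval_mvar mconst_hom)

lemma rename_eq_0_iff: "rename p = 0 \<longleftrightarrow> p = 0"
proof
  interpret r: unital_ring_hom "rename :: 'a mpoly \<Rightarrow> nat mpoly" by (rule rename_hom)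
  show "p = 0 \<Longrightarrow> rename p = 0" by (simp add: r.hom_zero)
  let ?back = "monoid_eval mconst (power_product (\<lambda>j. mvar (inv_into UNIV var_index j))) :: nat mpoly \<Rightarrow> 'a mpoly"
  interpret b: unital_ring_hom ?back by (rule power_product_eval_hom[OF mconst_hom])
  have "?back (rename q) = q" for q :: "'a mpoly"
    by (rule mpoly_hom_eqI[where \<psi> = "\<lambda>x. x"])
      (simp_all add: unital_ring_hom_comp rename_hom b.unital_ring_hom_axioms id_hom rename_mconst rename_mvar
        monoid_eval_mconst monoid_eval_mvar mconst_hom inj_var_index)
  then show "rename p = 0 \<Longrightarrow> p = 0" using b.hom_zero by metis
qed

lemma mpoly_mult_eq_0_iff: "p * q = 0 \<longleftrightarrow> p = 0 \<or> q = 0" for p q :: "'n::finite mpoly"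
proof -
  interpret r: unital_ring_hom "rename :: 'n mpoly \<Rightarrow> nat mpoly" by (rule rename_hom)
  have "rename (p * q) = 0 \<longleftrightarrow> rename p = 0 \<or> rename q = 0" by (simp add: r.hom_mult)
  then show ?thesis by (simp add: rename_eq_0_iff)
qed

text \<open>A pointed cone \<open>N\<close> containing all squares generates, by allowing quotients, a cone of
  the field of rational functions. A maximal cone above it orders an extension field in which the variables
  themselves are a point where all elements of \<open>G\<close> are positive, and \<open>cone_specializes\<close> turns it
  into a real point. With \<open>N\<close> generated by the squares and \<open>- f\<close> this contains Artin's solution of Hilbert's
  seventeenth problem.\<close>

theorem pointed_cone_positive_point:
  fixes N :: "'n::finite mpoly set"
  assumes add: "\<And>f g. f \<in> N \<Longrightarrow> g \<in> N \<Longrightarrow> f + g \<in> N"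
    and mult: "\<And>f g. f \<in> N \<Longrightarrow> g \<in> N \<Longrightarrow> f * g \<in> N"
    and squares: "\<And>f. f\<^sup>2 \<in> N"
    and pointed: "\<And>f. f \<in> N \<Longrightarrow> - f \<in> N \<Longrightarrow> f = 0"
    and G: "finite G" "G \<subseteq> N" "0 \<notin> G"
  obtains x where "\<And>g. g \<in> G \<Longrightarrow> eval_mpoly g x > 0"
proof -
  define \<iota> :: "'n mpoly \<Rightarrow> ambient" where "\<iota> p = embed (rename p)" for p
  interpret \<iota>: unital_ring_hom \<iota>
    unfolding \<iota>_def by (rule unital_ring_hom_comp[OF rename_hom embed_hom])
  have \<iota>0: "\<iota> p = 0 \<longleftrightarrow> p = 0" for p by (simp add: \<iota>_def embed_eq_0_iff rename_eq_0_iff)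
  \<comment> \<open>Quotients of elements of N; pointedness of N is what keeps - 1 out.\<close>
  define Q where "Q = {\<iota> t / \<iota> s | t s. t \<in> N \<and> s \<in> N \<and> s \<noteq> 0}"
  have QI: "y \<in> Q" if "y = \<iota> t / \<iota> s" "t \<in> N" "s \<in> N" "s \<noteq> 0" for y t s using that by (auto simp: Q_def)
  have QE: "\<exists>t\<in>N. \<exists>s\<in>N. s \<noteq> 0 \<and> y = \<iota> t / \<iota> s" if "y \<in> Q" for y using that by (auto simp: Q_def)
  have one: "1 \<in> N" using squares[of 1] by simp
  have zero: "0 \<in> N" using squares[of 0] by simp
  have NQ: "\<iota> t \<in> Q" if "t \<in> N" for t using QI[of _ t 1] that one by (simp add: \<iota>.hom_one)
  have "field_cone Q"
    unfolding field_cone_def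
  proof (intro conjI ballI)
    show "1 \<in> Q" using NQ[OF one] by (simp add: \<iota>.hom_one)
    show "- 1 \<notin> Q"
    proof
      assume "- 1 \<in> Q"
      then obtain t s where ts: "t \<in> N" "s \<in> N" "s \<noteq> 0" "- 1 = \<iota> t / \<iota> s" using QE by blast
      then have "\<iota> t = - \<iota> s" using \<iota>0[of s] by (simp add: eq_divide_eq)
      then have "\<iota> (t + s) = 0" by (simp add: \<iota>.hom_add)
      then have "t = - s" by (simp add: \<iota>0 eq_neg_iff_add_eq_0)
      then show False using pointed[of s] ts by simp
    qed
    show "inverse y \<in> Q" if y: "y \<in> Q" for y
    proof -
      obtain t s where ts: "t \<in> N" "s \<in> N" "s \<noteq> 0" "y = \<iota> t / \<iota> s" using QE[OF y] by blast
      show ?thesis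
      proof (cases "t = 0")
        case True
        then show ?thesis using ts y by (simp add: \<iota>.hom_zero)
      next
        case False
        then show ?thesis using ts by (intro QI[of _ s t]) simp_all
      qed
    qed
    fix y z assume yz: "y \<in> Q" "z \<in> Q"
    obtain t s t' s' where ts: "t \<in> N" "s \<in> N" "s \<noteq> 0" "t' \<in> N" "s' \<in> N" "s' \<noteq> 0"
      and eq: "y = \<iota> t / \<iota> s" "z = \<iota> t' / \<iota> s'"
      using QE[OF yz(1)] QE[OF yz(2)] by blast
    have ne: "s * s' \<noteq> 0" using ts by (simp add: mpoly_mult_eq_0_iff)
    have ne': "\<iota> s \<noteq> 0" "\<iota> s' \<noteq> 0" using ts by (simp_all add: \<iota>0)
    have "y + z = \<iota> (t * s' + t' * s) / \<iota> (s * s')"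
      unfolding eq \<iota>.hom_add \<iota>.hom_mult by (rule add_frac_eq[OF ne'])
    then show "y + z \<in> Q" by (rule QI) (intro add mult ts ne)+
    have "y * z = \<iota> (t * t') / \<iota> (s * s')" unfolding eq by (simp add: \<iota>.hom_mult)
    then show "y * z \<in> Q" by (rule QI) (intro mult ts ne)+
    have "y - z = \<iota> (t * s' - t' * s) / \<iota> (s * s')"
      unfolding eq \<iota>.hom_diff \<iota>.hom_mult by (rule diff_frac_eq[OF ne'])
    then have sq: "(y - z)\<^sup>2 = \<iota> ((t * s' - t' * s)\<^sup>2) / \<iota> ((s * s')\<^sup>2)"
      by (simp add: \<iota>.hom_power power_divide)
    have ne2: "(s * s')\<^sup>2 \<noteq> 0" using ne mpoly_mult_eq_0_iff[of "s * s'" "s * s'"] by (simp add: power2_eq_square)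
    show "(y - z)\<^sup>2 \<in> Q" by (rule QI[OF sq squares squares ne2])
  qed
  then obtain P where P: "max_cone P" "Q \<subseteq> P" by (rule max_cone_exists)
  have cone: "field_cone P" using P(1) by (simp add: max_cone_def)
  have \<iota>_const: "\<iota> (mconst c) = ambient_const c" for c
    by (simp add: \<iota>_def rename_mconst ambient_const_def)
  have "ambient_const c \<in> P" if "c \<ge> 0" for c
  proof -
    have "(mconst (sqrt c) :: 'n mpoly)\<^sup>2 = mconst c"
      using that by (simp flip: unital_ring_hom.hom_power[OF mconst_hom])
    then have "mconst c \<in> N" using squares by metis
    then show ?thesis using NQ P(2) \<iota>_const by fastforce
  qed
  then have real: "real_cone P" using P(1) by (auto simp: real_cone_def)
  have diff: "\<iota> p \<in> diff_field P" for p
  proof -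
    \<comment> \<open>Every polynomial is a difference of two squares and hence lies in the field of the cone.\<close>
    define c :: "'n mpoly" where "c = mconst (1 / 2)"
    have c: "c + c = 1" by (simp add: c_def mconst_def flip: single_add)
    define h where "h = c * (p + 1)"
    define k where "k = c * (p - 1)"
    have "h + k = (c + c) * p" "h - k = c + c" by (simp_all add: h_def k_def algebra_simps)
    then have "(h + k) * (h - k) = p" by (simp add: c)
    then have "p = h\<^sup>2 - k\<^sup>2" by (simp add: power2_eq_square algebra_simps)
    then have "\<iota> p = \<iota> (h\<^sup>2) - \<iota> (k\<^sup>2)" using \<iota>.hom_diff by metis
    then show ?thesis using NQ squares P(2) unfolding diff_field_def by blast
  qed
  \<comment> \<open>The generic point: the variables themselves, and 1 at the unused indices.\<close>
  define a where "a j = (if j \<in> range (var_index :: 'n \<Rightarrow> nat) then \<iota> (mvar (inv_into UNIV var_index j)) else 1)" for j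
  have eval_a: "monoid_eval ambient_const (power_product a) (rename p) = \<iota> p" for p
    by (rule mpoly_hom_eqI[where \<psi> = \<iota>])
      (simp_all add: unital_ring_hom_comp rename_hom power_product_eval_hom ambient_const_hom
        \<iota>.unital_ring_hom_axioms rename_mconst rename_mvar monoid_eval_mconst monoid_eval_mvar \<iota>_const
        a_def inj_var_index)
  have "\<exists>b. \<forall>g\<in>rename ` G. monoid_eval (\<lambda>c :: real. c) (power_product b) g > 0"
  proof (rule cone_specializes[OF real, of "range (var_index :: 'n \<Rightarrow> nat)" a])
    show "a i \<in> diff_field P" for i
      using diff diff_field_closed(3)[OF cone] by (simp add: a_def)
    show "monoid_eval ambient_const (power_product a) g \<in> P - {0}" if g: "g \<in> rename ` G" for g
    proof -
      obtain g' where g': "g' \<in> G" "g = rename g'" using g by blast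
      then have "\<iota> g' \<in> P" "g' \<noteq> 0" using G NQ P(2) by auto
      then show ?thesis by (simp add: g'(2) eval_a \<iota>0)
    qed
  qed (use G in \<open>auto simp: a_def\<close>)
  then obtain b where b: "\<And>g. g \<in> G \<Longrightarrow> monoid_eval (\<lambda>c. c) (power_product b) (rename g) > 0" by auto
  have "monoid_eval (\<lambda>c. c) (power_product b) (rename p) = eval_mpoly p (\<chi> i. b (var_index i))" for p :: "'n mpoly"
  proof (rule mpoly_hom_eqI[where \<psi> = "\<lambda>p. eval_mpoly p (\<chi> i. b (var_index i))"])
    show "unital_ring_hom (\<lambda>p. eval_mpoly p (\<chi> i. b (var_index i)))" by standard simp_all
    have single: "(\<Prod>j\<in>UNIV. b (var_index j) ^ Poly_Mapping.lookup (Poly_Mapping.single i 1) j) = b (var_index i)" for i :: 'n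
      by (subst prod.remove[of _ i]) (auto simp: lookup_single intro!: prod.neutral)
    show "monoid_eval (\<lambda>c. c) (power_product b) (rename (mvar i)) = eval_mpoly (mvar i) (\<chi> i. b (var_index i))" for i :: 'n
      unfolding rename_mvar monoid_eval_mvar[OF id_hom]
      unfolding mvar_def eval_mpoly_single vec_lambda_beta mult_1_left by (rule single[symmetric])
  qed (simp_all add: unital_ring_hom_comp rename_hom power_product_eval_hom id_hom rename_mconst
      monoid_eval_mconst, simp add: mconst_def)
  then show ?thesis using that b by metis
qed

section \<open>Zariski density\<close>

text \<open>Induction on the variables: those outside \<open>V\<close> are left out of the monomials, so monomials which
  agree on \<open>V\<close> are collected. For \<open>V\<close> the set of all variables this is the vanishing of every
  coefficient of a polynomial that is zero as a function.\<close>

lemma vanishing_power_sums: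
  fixes c :: "('n \<Rightarrow>\<^sub>0 nat) \<Rightarrow> real"
  assumes "finite V" "finite K" "\<And>x. (\<Sum>m\<in>K. c m * (\<Prod>i\<in>V. x i ^ Poly_Mapping.lookup m i)) = 0"
  shows "(\<Sum>m | m \<in> K \<and> (\<forall>i\<in>V. Poly_Mapping.lookup m i = Poly_Mapping.lookup m0 i). c m) = 0"
  using assms
proof (induction V arbitrary: K)
  case empty
  then show ?case by simp
next
  case (insert v V)
  let ?t = "\<lambda>x m. c m * (\<Prod>i\<in>V. x i ^ Poly_Mapping.lookup m i)"
  let ?K = "{m \<in> K. Poly_Mapping.lookup m v = Poly_Mapping.lookup m0 v}"
  have "(\<Sum>m\<in>?K. ?t x m) = 0" for x
  proof -
    \<comment> \<open>As a polynomial in the variable v alone it vanishes on all reals, so each of its coefficients is 0.\<close>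
    define q where "q = (\<Sum>m\<in>K. monom (?t x m) (Poly_Mapping.lookup m v))"
    have "poly q y = 0" for y
    proof -
      have "(\<Prod>i\<in>V. (x(v := y)) i ^ Poly_Mapping.lookup m i) = (\<Prod>i\<in>V. x i ^ Poly_Mapping.lookup m i)" for m
        by (rule prod.cong) (use insert.hyps in auto)
      then show ?thesis
        using insert.prems(2)[of "x(v := y)"] insert.hyps
        by (simp add: q_def poly_sum poly_monom mult_ac)
    qed
    then have "q = 0" using poly_all_0_iff_0 by blast
    then have "coeff q (Poly_Mapping.lookup m0 v) = 0" by simp
    then show ?thesis
      using insert.prems(1) by (simp add: q_def coeff_sum coeff_monom sum.If_cases Int_def)
  qed
  moreover have "finite ?K" using insert.prems(1) by simp
  ultimately have "(\<Sum>m | m \<in> ?K \<and> (\<forall>i\<in>V. Poly_Mapping.lookup m i = Poly_Mapping.lookup m0 i). c m) = 0"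
    by (intro insert.IH)
  moreover have "{m. m \<in> ?K \<and> (\<forall>i\<in>V. Poly_Mapping.lookup m i = Poly_Mapping.lookup m0 i)} =
      {m. m \<in> K \<and> (\<forall>i\<in>insert v V. Poly_Mapping.lookup m i = Poly_Mapping.lookup m0 i)}"
    by auto
  ultimately show ?case by simp
qed

lemma eval_mpoly_eq_0_imp:
  assumes "\<And>x. eval_mpoly p x = 0"
  shows "p = 0"
proof (rule poly_mapping_eqI)
  fix m0
  have "(\<Sum>m | m \<in> Poly_Mapping.keys p \<and> (\<forall>i\<in>UNIV. Poly_Mapping.lookup m i = Poly_Mapping.lookup m0 i).
      Poly_Mapping.lookup p m) = 0"
    by (rule vanishing_power_sums) (use assms[of "\<chi> i. x i" for x] in \<open>simp_all add: eval_mpoly_def\<close>)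
  moreover have "{m. m \<in> Poly_Mapping.keys p \<and> (\<forall>i\<in>UNIV. Poly_Mapping.lookup m i = Poly_Mapping.lookup m0 i)}
      = Poly_Mapping.keys p \<inter> {m0}"
    by (auto intro: poly_mapping_eqI)
  ultimately show "Poly_Mapping.lookup p m0 = Poly_Mapping.lookup 0 m0"
    by (cases "m0 \<in> Poly_Mapping.keys p") (auto simp: in_keys_iff)
qed

lemma zariski_dense_iff:
  "zariski_dense S \<longleftrightarrow> (\<forall>p. (\<forall>x\<in>S. eval_mpoly p x = 0) \<longrightarrow> p = 0)"
proof
  assume dense: "zariski_dense S"
  show "\<forall>p. (\<forall>x\<in>S. eval_mpoly p x = 0) \<longrightarrow> p = 0"
  proof (intro allI impI)
    fix p assume p: "\<forall>x\<in>S. eval_mpoly p x = 0"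
    have "closedin zariski {x. eval_mpoly p x = 0}"
      unfolding closedin_zariski zariski_closed_def by (rule exI[of _ "{p}"]) simp
    then have "zariski closure_of S \<subseteq> {x. eval_mpoly p x = 0}"
      by (rule closure_of_minimal[rotated]) (use p in auto)
    then show "p = 0" using dense by (intro eval_mpoly_eq_0_imp) (auto simp: zariski_dense_def)
  qed
next
  assume *: "\<forall>p. (\<forall>x\<in>S. eval_mpoly p x = 0) \<longrightarrow> p = 0"
  have "closedin zariski (zariski closure_of S)" by simp
  then obtain P where P: "zariski closure_of S = {x. \<forall>p\<in>P. eval_mpoly p x = 0}"
    unfolding closedin_zariski zariski_closed_def by blast
  have "S \<subseteq> zariski closure_of S" by (rule closure_of_subset) simp
  then have "p = 0" if "p \<in> P" for p using * that P by blast
  then show "zariski_dense S" unfolding zariski_dense_def P by force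
qed

section \<open>Leading components in a graded polynomial ring\<close>

locale graded_polynomials =
  fixes A :: "'g::linordered_ab_group_add \<Rightarrow> 'n::finite mpoly set"
  assumes grading: "grading A"
begin

definition component :: "'n mpoly \<Rightarrow> 'g \<Rightarrow> 'n mpoly" where
  "component f \<gamma> = Poly_Mapping.lookup (components A f) \<gamma>"

lemma A_closed:
  "0 \<in> A \<gamma>" "p \<in> A \<gamma> \<Longrightarrow> q \<in> A \<gamma> \<Longrightarrow> p + q \<in> A \<gamma>" "p \<in> A \<gamma> \<Longrightarrow> - p \<in> A \<gamma>"
  "p \<in> A \<gamma> \<Longrightarrow> q \<in> A \<delta> \<Longrightarrow> p * q \<in> A (\<gamma> + \<delta>)"
  using grading subspace_0[of "A \<gamma>"] subspace_add[of "A \<gamma>" p q] subspace_neg[of "A \<gamma>" p]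
  by (auto simp: grading_def)

lemma components_unique: "decomposes A f c \<Longrightarrow> components A f = c"
  using grading unfolding grading_def components_def by (metis the1_equality)

lemma decomposes_components: "decomposes A f (components A f)"
  using grading unfolding grading_def components_def by (metis theI')

lemma component_in: "component f \<gamma> \<in> A \<gamma>"
  using decomposes_components by (simp add: decomposes_def component_def)

lemma sum_component: "f = (\<Sum>\<gamma>\<in>Poly_Mapping.keys (components A f). component f \<gamma>)"
  using decomposes_components[of f] by (simp add: decomposes_def component_def)

lemma decomposes_add:
  assumes "decomposes A f c" "decomposes A g d"
  shows "decomposes A (f + g) (c + d)"
proof -
  let ?S = "Poly_Mapping.keys c \<union> Poly_Mapping.keys d"
  have sup: "(\<Sum>\<gamma>\<in>Poly_Mapping.keys e. Poly_Mapping.lookup e \<gamma>) = (\<Sum>\<gamma>\<in>?S. Poly_Mapping.lookup e \<gamma>)"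
    if "Poly_Mapping.keys e \<subseteq> ?S" for e :: "'g \<Rightarrow>\<^sub>0 'n mpoly"
    by (rule sum.mono_neutral_left) (use that in \<open>auto simp: in_keys_iff\<close>)
  have "f + g = (\<Sum>\<gamma>\<in>?S. Poly_Mapping.lookup c \<gamma>) + (\<Sum>\<gamma>\<in>?S. Poly_Mapping.lookup d \<gamma>)"
    using assms sup[of c] sup[of d] by (simp add: decomposes_def)
  also have "\<dots> = (\<Sum>\<gamma>\<in>?S. Poly_Mapping.lookup (c + d) \<gamma>)"
    by (simp add: lookup_add sum.distrib)
  also have "\<dots> = (\<Sum>\<gamma>\<in>Poly_Mapping.keys (c + d). Poly_Mapping.lookup (c + d) \<gamma>)"
    by (rule sup[symmetric]) (rule Poly_Mapping.keys_add)
  finally show ?thesis using assms A_closed(2) by (simp add: decomposes_def lookup_add)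
qed

lemma component_add: "component (f + g) \<gamma> = component f \<gamma> + component g \<gamma>"
  using components_unique[OF decomposes_add[OF decomposes_components decomposes_components], of f g]
  by (simp add: component_def lookup_add)

lemma component_homogeneous:
  assumes "f \<in> A \<gamma>"
  shows "component f \<delta> = (if \<delta> = \<gamma> then f else 0)"
proof -
  have "decomposes A f (Poly_Mapping.single \<gamma> f)"
    using assms A_closed(1) by (auto simp: decomposes_def lookup_single when_def)
  then show ?thesis by (simp add: component_def components_unique lookup_single when_def)
qed

lemma component_zero [simp]: "component 0 \<gamma> = 0"
  using component_homogeneous[OF A_closed(1)[of \<gamma>], of \<gamma>] by simp

lemma component_uminus: "component (- f) \<gamma> = - component f \<gamma>"
  using component_add[of f "- f" \<gamma>] by (simp add: eq_neg_iff_add_eq_0 add.commute)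

lemma component_diff: "component (f - g) \<gamma> = component f \<gamma> - component g \<gamma>"
  using component_add[of f "- g" \<gamma>] by (simp add: component_uminus)

lemma component_sum: "component (sum f S) \<gamma> = (\<Sum>x\<in>S. component (f x) \<gamma>)"
  by (induction S rule: infinite_finite_induct) (simp_all add: component_add)

definition below :: "'g \<Rightarrow> 'n mpoly set" where
  "below d = {f. \<forall>\<gamma>\<ge>d. component f \<gamma> = 0}"

definition at_most :: "'g \<Rightarrow> 'n mpoly set" where
  "at_most d = {f. \<forall>\<gamma>>d. component f \<gamma> = 0}"

text \<open>Strictly smaller degrees stay strictly smaller after multiplication, as the order of the group is
  compatible with addition.\<close>

lemma below_at_most_mult:
  assumes "f \<in> below d" "g \<in> at_most e"
  shows "f * g \<in> below (d + e)"
proof -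
  let ?F = "Poly_Mapping.keys (components A f)" and ?G = "Poly_Mapping.keys (components A g)"
  have eq: "f * g = (\<Sum>\<gamma>\<in>?F. \<Sum>\<delta>\<in>?G. component f \<gamma> * component g \<delta>)"
    by (subst (1 2) sum_component) (rule sum_product)
  have "component (component f \<gamma> * component g \<delta>) \<epsilon> = 0" if "\<gamma> \<in> ?F" "\<delta> \<in> ?G" "\<epsilon> \<ge> d + e" for \<gamma> \<delta> \<epsilon>
  proof -
    have "\<gamma> < d" using assms(1) that(1) by (auto simp: below_def component_def in_keys_iff not_le[symmetric])
    moreover have "\<delta> \<le> e" using assms(2) that(2) by (auto simp: at_most_def component_def in_keys_iff not_less[symmetric])
    ultimately have "\<gamma> + \<delta> \<noteq> \<epsilon>" using that(3) by (metis add_less_le_mono not_le)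
    then show ?thesis using component_homogeneous[OF A_closed(4)[OF component_in component_in]] by simp
  qed
  then show ?thesis unfolding below_def by (subst eq) (simp add: component_sum)
qed

text \<open>Relates \<open>f\<close> to its degree and leading component at once. Working with this relation avoids
  maxima over supports.\<close>

definition has_lead :: "'n mpoly \<Rightarrow> 'g \<Rightarrow> 'n mpoly \<Rightarrow> bool" where
  "has_lead f d g \<longleftrightarrow> g \<in> A d \<and> g \<noteq> 0 \<and> f - g \<in> below d"

lemma has_lead_component: "has_lead f d g \<Longrightarrow> \<gamma> \<ge> d \<Longrightarrow> component f \<gamma> = (if \<gamma> = d then g else 0)"
  using component_homogeneous[of g d \<gamma>] by (auto simp: has_lead_def below_def component_diff)

lemma has_lead_at_most: "has_lead f d g \<Longrightarrow> f \<in> at_most d"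
  by (simp add: at_most_def has_lead_component)

lemma has_leadD:
  assumes "has_lead f d g"
  shows "f \<noteq> 0" "gdeg A f = Fin d" "gmax A f = g"
proof -
  have g: "g \<noteq> 0" using assms by (simp add: has_lead_def)
  have d: "component f d = g" using has_lead_component[OF assms, of d] by simp
  then show "f \<noteq> 0" using g by auto
  have "d \<in> Poly_Mapping.keys (components A f)"
    using d g by (simp add: component_def in_keys_iff)
  moreover have "\<gamma> \<le> d" if "\<gamma> \<in> Poly_Mapping.keys (components A f)" for \<gamma>
  proof (rule ccontr)
    assume "\<not> \<gamma> \<le> d"
    then have "component f \<gamma> = 0" using has_lead_component[OF assms, of \<gamma>] by auto
    then show False using that by (simp add: component_def in_keys_iff)
  qed
  ultimately have "Max (Poly_Mapping.keys (components A f)) = d" by (intro Max_eqI) auto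
  then show "gdeg A f = Fin d" "gmax A f = g"
    using \<open>f \<noteq> 0\<close> d by (simp_all add: gdeg_def gmax_def component_def)
qed

lemma has_lead_gmax:
  assumes "f \<noteq> 0"
  obtains d where "has_lead f d (gmax A f)"
proof
  let ?K = "Poly_Mapping.keys (components A f)"
  define d where "d = Max ?K"
  have "?K \<noteq> {}" using sum_component[of f] assms by auto
  then have "d \<in> ?K" and max: "\<And>\<gamma>. \<gamma> \<in> ?K \<Longrightarrow> \<gamma> \<le> d" by (simp_all add: d_def)
  have eq: "gmax A f = component f d" by (simp add: gmax_def component_def d_def)
  have "component f d \<noteq> 0" using \<open>d \<in> ?K\<close> by (simp add: component_def in_keys_iff)
  moreover have "component (f - component f d) \<gamma> = 0" if "\<gamma> \<ge> d" for \<gamma>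
  proof -
    have "component f \<gamma> = 0" if "\<gamma> \<noteq> d"
      using max[of \<gamma>] \<open>\<gamma> \<ge> d\<close> that by (auto simp: component_def in_keys_iff)
    then show ?thesis using component_homogeneous[OF component_in, of f d \<gamma>] by (auto simp: component_diff)
  qed
  ultimately show "has_lead f d (gmax A f)"
    unfolding eq has_lead_def below_def using component_in by blast
qed

text \<open>The leading components multiply without cancellation because the polynomial ring is a domain.\<close>

lemma has_lead_mult:
  assumes "has_lead f d g" "has_lead f' d' g'"
  shows "has_lead (f * f') (d + d') (g * g')"
proof -
  have g: "g \<in> A d" "g \<noteq> 0" "f - g \<in> below d" and g': "g' \<in> A d'" "g' \<noteq> 0" "f' - g' \<in> below d'"
    using assms by (auto simp: has_lead_def)
  have "g \<in> at_most d" using component_homogeneous[OF g(1)] by (auto simp: at_most_def)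
  then have "(f' - g') * g \<in> below (d + d')"
    using below_at_most_mult[OF g'(3)] by (simp add: add.commute)
  moreover have "(f - g) * f' \<in> below (d + d')" using below_at_most_mult[OF g(3) has_lead_at_most[OF assms(2)]] .
  moreover have "f * f' - g * g' = (f - g) * f' + (f' - g') * g" by (simp add: algebra_simps)
  ultimately have "f * f' - g * g' \<in> below (d + d')" by (simp add: below_def component_add)
  then show ?thesis using g g' A_closed(4) by (simp add: has_lead_def mpoly_mult_eq_0_iff)
qed

lemma has_lead_add_less:
  assumes "has_lead f d g" "has_lead f' d' g'" "d < d'"
  shows "has_lead (f + f') d' g'"
proof -
  have "component f \<gamma> = 0" if "\<gamma> \<ge> d'" for \<gamma>
    using has_lead_at_most[OF assms(1)] assms(3) that by (auto simp: at_most_def)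
  then show ?thesis using assms(2) by (auto simp: has_lead_def below_def component_add component_diff)
qed

lemma has_lead_add_eq:
  assumes "has_lead f d g" "has_lead f' d g'"
  shows "g + g' \<noteq> 0 \<Longrightarrow> has_lead (f + f') d (g + g')"
    and "g + g' = 0 \<Longrightarrow> f + f' \<in> below d"
proof -
  have *: "component (f + f') \<gamma> = component (g + g') \<gamma>" if "\<gamma> \<ge> d" for \<gamma>
    using assms that by (simp add: has_lead_def below_def component_add component_diff)
  show "has_lead (f + f') d (g + g')" if "g + g' \<noteq> 0"
    using assms A_closed(2) that * by (auto simp: has_lead_def below_def component_diff)
  show "f + f' \<in> below d" if "g + g' = 0"
    using * that by (auto simp: below_def)
qed

lemma gdeg_below:
  assumes "f \<in> below d"
  shows "gdeg A f < Fin d"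
proof (cases "f = 0")
  case True
  then show ?thesis by (simp add: gdeg_def)
next
  case False
  then obtain e where e: "has_lead f e (gmax A f)" by (rule has_lead_gmax)
  then have "component f e \<noteq> 0" using has_lead_component[OF e, of e] by (simp add: has_lead_def)
  then have "e < d" using assms by (auto simp: below_def not_le[symmetric])
  then show ?thesis using has_leadD(2)[OF e] by simp
qed

lemma has_lead_square: "has_lead a d b \<Longrightarrow> has_lead (a\<^sup>2) (d + d) (b\<^sup>2)"
  unfolding power2_eq_square by (rule has_lead_mult)

end

section \<open>Quadratic modules and total stability\<close>

text \<open>Membership in a quadratic module as an induction principle, so that invariants are checked on
  \<open>0\<close>, \<open>1\<close>, generators, sums and multiples by squares only.\<close>

lemma QM_induct [consumes 1, case_names zero one gen add square_mult]:
  fixes F :: "'n mpoly set"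
  assumes "h \<in> QM F" and zero: "P 0" and one: "P 1" and gen: "\<And>f. f \<in> F \<Longrightarrow> P f"
    and add: "\<And>f g. P f \<Longrightarrow> P g \<Longrightarrow> P (f + g)" and mult: "\<And>a f. P f \<Longrightarrow> P (a\<^sup>2 * f)"
  shows "P h"
proof -
  have sum: "P (sum f S)" if "\<And>x. x \<in> S \<Longrightarrow> P (f x)" for f :: "'x \<Rightarrow> 'n mpoly" and S
    using that by (induction S rule: infinite_finite_induct) (auto intro: zero add)
  have sos: "P (s * f)" if s: "s \<in> sums_of_squares" "P f" for s f
  proof -
    obtain k :: nat and a where "s = (\<Sum>i<k. (a i)\<^sup>2)" using s(1) by (auto simp: sums_of_squares_def)
    then show ?thesis using s(2) by (auto simp: sum_distrib_right intro!: sum mult)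
  qed
  obtain \<sigma>0 \<sigma> where "h = \<sigma>0 + (\<Sum>f\<in>F. \<sigma> f * f)" "\<sigma>0 \<in> sums_of_squares" "\<And>f. f \<in> F \<Longrightarrow> \<sigma> f \<in> sums_of_squares"
    using assms(1) by (auto simp: QM_def)
  moreover from this have "P \<sigma>0" using sos[of \<sigma>0 1] one by simp
  moreover from calculation have "P (\<Sum>f\<in>F. \<sigma> f * f)" by (intro sum sos gen)
  ultimately show ?thesis by (simp add: add)
qed

lemma zero_in_sums_of_squares: "0 \<in> sums_of_squares"
  unfolding sums_of_squares_def by (auto intro!: exI[of _ "0::nat"])

lemma one_in_sums_of_squares: "1 \<in> sums_of_squares"
  unfolding sums_of_squares_def
  by (intro CollectI exI[of _ "1 :: nat"] exI[of _ "\<lambda>_. 1"]) simp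

lemma generator_in_QM:
  assumes "finite F" "f \<in> F"
  shows "f \<in> QM F"
proof -
  let ?\<sigma> = "\<lambda>g. if g = f then 1 else 0"
  have "f = 0 + (\<Sum>g\<in>F. ?\<sigma> g * g)" using assms by (simp add: sum.remove[of F f])
  then show ?thesis
    unfolding QM_def
    by (intro CollectI exI[of _ 0] exI[of _ ?\<sigma>])
      (simp add: zero_in_sums_of_squares one_in_sums_of_squares)
qed

context graded_polynomials
begin

text \<open>Let \<open>K\<close> consist of \<open>0\<close> and the polynomials whose leading component is nonnegative on \<open>S\<close>. Two
  leading components in the same degree cannot cancel: each would vanish on the dense set \<open>S\<close>. So
  \<open>K\<close> is closed under addition without loss of degree, and it contains the quadratic module.\<close>

theorem totally_stable_if_dense:
  assumes F: "generators F M" and dense: "zariski_dense (nonneg_set (gmax A ` F))"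
  shows "totally_stable A M"
proof -
  define S where "S = nonneg_set (gmax A ` F)"
  define K where "K h \<longleftrightarrow> h = 0 \<or> (\<forall>x\<in>S. eval_mpoly (gmax A h) x \<ge> 0)" for h
  have K_lead: "K h \<longleftrightarrow> (\<forall>x\<in>S. eval_mpoly g x \<ge> 0)" if "has_lead h d g" for h d g
    using has_leadD[OF that] by (simp add: K_def)
  have sum: "K (f + g) \<and> gdeg A f \<le> gdeg A (f + g)" if "K f" "K g" for f g
  proof (cases "f = 0 \<or> g = 0")
    case True
    then show ?thesis using that by (auto simp: gdeg_def)
  next
    case False
    then obtain d e where d: "has_lead f d (gmax A f)" and e: "has_lead g e (gmax A g)"
      using has_lead_gmax by metis
    note pos = that[unfolded K_lead[OF d] K_lead[OF e]]
    show ?thesis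
    proof (cases d e rule: linorder_cases)
      case less
      then have l: "has_lead (f + g) e (gmax A g)" using has_lead_add_less d e by blast
      show ?thesis using has_leadD(2)[OF l] has_leadD(2)[OF d] less pos by (simp add: K_lead[OF l])
    next
      case greater
      then have l: "has_lead (f + g) d (gmax A f)" using has_lead_add_less[OF e d] by (simp add: add.commute)
      show ?thesis using has_leadD(2)[OF l] has_leadD(2)[OF d] pos by (simp add: K_lead[OF l])
    next
      case equal
      have "gmax A f + gmax A g \<noteq> 0"
      proof
        assume 0: "gmax A f + gmax A g = 0"
        have "eval_mpoly (gmax A f) x = 0" if "x \<in> S" for x
          using pos that eval_mpoly_add[of "gmax A f" "gmax A g" x] unfolding 0 by fastforce
        then have "gmax A f = 0" using dense by (simp add: zariski_dense_iff S_def)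
        then show False using d by (simp add: has_lead_def)
      qed
      then have l: "has_lead (f + g) d (gmax A f + gmax A g)"
        using has_lead_add_eq(1) d e equal by blast
      show ?thesis using has_leadD(2)[OF l] has_leadD(2)[OF d] pos by (simp add: K_lead[OF l])
    qed
  qed
  have "K h" if "h \<in> QM F" for h
    using that
  proof (induction rule: QM_induct)
    case zero
    then show ?case by (simp add: K_def)
  next
    case one
    obtain d where d: "has_lead 1 d (gmax A 1)" using has_lead_gmax[of 1] by auto
    then have "has_lead 1 (d + d) ((gmax A 1)\<^sup>2)" using has_lead_square[of 1 d] by simp
    then show ?case by (simp add: K_lead power2_eq_square)
  next
    case (gen f)
    then show ?case by (auto simp: K_def S_def nonneg_set_def)
  next
    case (add f g)
    then show ?case using sum by blast
  next
    case (square_mult a f)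
    show ?case
    proof (cases "a = 0 \<or> f = 0")
      case False
      then obtain d e where d: "has_lead a d (gmax A a)" and e: "has_lead f e (gmax A f)"
        using has_lead_gmax by metis
      have "has_lead (a\<^sup>2 * f) (d + d + e) ((gmax A a)\<^sup>2 * gmax A f)"
        using has_lead_mult[OF has_lead_square[OF d] e] .
      then show ?thesis using square_mult by (simp add: K_lead K_lead[OF e] power2_eq_square)
    qed (auto simp: K_def)
  qed
  then show ?thesis using F sum by (simp add: totally_stable_def generators_def)
qed

text \<open>Let \<open>N\<close> consist of \<open>0\<close> and the polynomials that share degree and leading component with an
  element of \<open>M\<close>. Total stability says that leading components of elements of \<open>M\<close> of the same degree
  never cancel, so \<open>N\<close> is a pointed cone. It contains all squares and the leading components of
  the generators, hence for \<open>p \<noteq> 0\<close> some real point makes \<open>p\<^sup>2\<close> and all these leading components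
  positive, and \<open>p\<close> cannot vanish on their nonnegativity set.\<close>

theorem dense_if_totally_stable:
  assumes qm: "quadratic_module M" and mult: "\<And>f g. f \<in> M \<Longrightarrow> g \<in> M \<Longrightarrow> f * g \<in> M"
    and stable: "totally_stable A M" and F: "generators F M"
  shows "zariski_dense (nonneg_set (gmax A ` F))"
proof -
  have M_add: "f + g \<in> M" if "f \<in> M" "g \<in> M" for f g using qm that by (simp add: quadratic_module_def)
  have M_square: "a\<^sup>2 \<in> M" for a
    using qm unfolding quadratic_module_def by (metis mult.right_neutral)
  have no_cancel: "f' + g' \<noteq> 0" if "f \<in> M" "g \<in> M" "has_lead f d f'" "has_lead g d g'" for f g d f' g'
  proof
    assume "f' + g' = 0"
    then have "gdeg A (f + g) < Fin d" using has_lead_add_eq(2) gdeg_below that by blast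
    moreover have "Fin d \<le> gdeg A (f + g)"
      using stable that has_leadD(2)[OF that(3)] by (metis totally_stable_def)
    ultimately show False by simp
  qed
  define N where "N = {h. h = 0 \<or> (\<exists>f\<in>M. \<exists>d g. has_lead f d g \<and> has_lead h d g)}"
  have N_add: "h + k \<in> N" "h + k = 0 \<Longrightarrow> h = 0" if hk: "h \<in> N" "k \<in> N" for h k
  proof -
    have "h + k \<in> N \<and> (h + k = 0 \<longrightarrow> h = 0)"
    proof (cases "h = 0 \<or> k = 0")
      case True
      then show ?thesis using hk by (auto simp: N_def)
    next
      case False
      then obtain f d f' g e g' where f: "f \<in> M" "has_lead f d f'" "has_lead h d f'"
        and g: "g \<in> M" "has_lead g e g'" "has_lead k e g'"
        using hk unfolding N_def by blast
      have "\<exists>d' l. has_lead (f + g) d' l \<and> has_lead (h + k) d' l"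
      proof (cases d e rule: linorder_cases)
        case less
        then show ?thesis using has_lead_add_less f g by blast
      next
        case greater
        then show ?thesis using has_lead_add_less[OF g(2) f(2)] has_lead_add_less[OF g(3) f(3)]
          by (metis add.commute)
      next
        case equal
        then show ?thesis using no_cancel[OF f(1) g(1) f(2)] has_lead_add_eq(1) f g by blast
      qed
      then show ?thesis using M_add[OF f(1) g(1)] has_leadD(1) unfolding N_def by blast
    qed
    then show "h + k \<in> N" "h + k = 0 \<Longrightarrow> h = 0" by auto
  qed
  have N_mult: "h * k \<in> N" if hk: "h \<in> N" "k \<in> N" for h k
  proof (cases "h = 0 \<or> k = 0")
    case True
    then show ?thesis by (auto simp: N_def)
  next
    case False
    then obtain f d f' g e g' where f: "f \<in> M" "has_lead f d f'" "has_lead h d f'"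
      and g: "g \<in> M" "has_lead g e g'" "has_lead k e g'"
      using hk unfolding N_def by blast
    then show ?thesis using has_lead_mult mult unfolding N_def by blast
  qed
  have N_square: "a\<^sup>2 \<in> N" for a
  proof (cases "a = 0")
    case False
    then obtain d where "has_lead a d (gmax A a)" by (rule has_lead_gmax)
    then show ?thesis using has_lead_square M_square unfolding N_def by blast
  qed (simp add: N_def)
  have N_gmax: "gmax A f \<in> N" "gmax A f \<noteq> 0" if "f \<in> F" for f
  proof -
    have f: "f \<in> M" "f \<noteq> 0" using that F generator_in_QM by (auto simp: generators_def)
    then obtain d where d: "has_lead f d (gmax A f)" using has_lead_gmax by blast
    then have "has_lead (gmax A f) d (gmax A f)" by (simp add: has_lead_def below_def)
    then show "gmax A f \<in> N" using d f unfolding N_def by blast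
    show "gmax A f \<noteq> 0" using d by (simp add: has_lead_def)
  qed
  show ?thesis
    unfolding zariski_dense_iff
  proof (intro allI impI, rule ccontr)
    fix p assume van: "\<forall>x\<in>nonneg_set (gmax A ` F). eval_mpoly p x = 0" and "p \<noteq> 0"
    \<comment> \<open>Including the square of p forces the positive point to be a non-zero of p.\<close>
    let ?G = "insert (p\<^sup>2) (gmax A ` F)"
    have "0 \<notin> ?G"
      using N_gmax(2) \<open>p \<noteq> 0\<close> mpoly_mult_eq_0_iff[of p p] by (auto simp: power2_eq_square)
    moreover have "finite ?G" using F by (simp add: generators_def)
    moreover have "?G \<subseteq> N" using N_square N_gmax(1) by auto
    moreover have "h = 0" if "h \<in> N" "- h \<in> N" for h using N_add(2)[OF that] by simp
    ultimately obtain x where x: "\<And>g. g \<in> ?G \<Longrightarrow> eval_mpoly g x > 0"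
      using pointed_cone_positive_point[of N ?G] N_add(1) N_mult N_square by blast
    then have "x \<in> nonneg_set (gmax A ` F)" by (auto simp: nonneg_set_def intro: less_imp_le)
    then show False using van x[of "p\<^sup>2"] by (simp add: power2_eq_square)
  qed
qed

end

theorem theorem4p3:
  fixes A :: "'g::linordered_ab_group_add \<Rightarrow> 'n::finite mpoly set"
    and M :: "'n mpoly set"
  assumes "grading A"
    and "quadratic_module M"
    and "fin_gen M"
  shows "((\<exists>F. generators F M \<and> zariski_dense (nonneg_set (gmax A ` F))) \<longrightarrow> totally_stable A M) \<and>
    ((\<forall>f\<in>M. \<forall>g\<in>M. f * g \<in> M) \<and> totally_stable A M \<longrightarrow>
       (\<forall>F. generators F M \<longrightarrow> zariski_dense (nonneg_set (gmax A ` F))))"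
proof -
  interpret graded_polynomials A by standard fact
  show ?thesis using totally_stable_if_dense dense_if_totally_stable[OF assms(2)] by blast
qed

end
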